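(* Let $\alpha>2$ and $r_{\mathrm{tr}}>0$. Consider orthogonal space time block coding (OSTBC) with $M$ transmit antennas, $N\ge M$ receive antennas, code rate $R(M)$ and code parameter $N_I(M)$, and let $\tilde{\mathrm{c}}_{\mathrm{OSTBC}}(\epsilon)$ be its transmission capacity under the approximate SINR model. Consider low outage probabilities $\epsilon$ and high transmit SNR $\rho$, and assume that the SINR threshold $\beta$ and $\epsilon$ are selected such that $\epsilon>\mathrm{F}^{\mathrm{SU}}(\beta)$, where $\mathrm{F}^{\mathrm{SU}}(\beta)$ is the outage probability without multi-node interference. Then, as $N$ grows large, for arbitrary values of $M$, $$\tilde{\mathrm{c}}_{\mathrm{OSTBC}}(\epsilon)=\Theta\left(g(M)N^{2/\alpha}\right),\qquad g(M)=R(M)\,M^{2/\alpha}\,\frac{\Gamma\left(\frac{N_I(M)}{M}\right)}{\Gamma\left(\frac{N_I(M)}{M}+\frac{2}{\alpha}\right)}.$$ In particular: (a) for minimum-rate (cyclic antenna diversity) codes, for which $R(M)=1/M$ and $N_I(M)=M$, $\tilde{\mathrm{c}}_{\mathrm{OSTBC}}(\epsilon)=\Theta\left(M^{\frac2\alpha-1}N^{\frac2\alpha}\right)$, which is maximized by $M=1$, yielding $\tilde{\mathrm{c}}_{\mathrm{OSTBC}}(\epsilon)=\Theta\left(N^{2/\alpha}\right)$; (b) for maximum-rate codes, for which, for $M$ even, $\frac12<R(M)\le\frac{M+2}{2M}$ and $N_I(M)=\frac{M(M+2)}{2}$, and, for $M$ odd, $\frac12<R(M)\le\frac{M+3}{2(M+1)}$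 and $\frac{M(M+1)}{2}\le N_I(M)<\frac{M(M+2)}{2}$, the best achievable scaling is $\tilde{\mathrm{c}}_{\mathrm{OSTBC}}(\epsilon)=\Theta\left(N^{2/\alpha}\right)$, regardless of whether $M$ is kept fixed or allowed to vary with $N$. Consequently, the transmission capacity of OSTBC scales only sub-linearly with the number of antennas $N$, regardless of the particular code employed.
   Context: Approximate SINR model for OSTBC: $$\gamma=\frac{W}{\sum_{\ell}|X_\ell|^{-\alpha}\Psi_{\ell 0}+1},$$ where $W\sim\mathrm{Gamma}\left(MN,\frac{\rho}{R(M)M\,r_{\mathrm{tr}}^{\alpha}}\right)$ (signal), $\{X_\ell\}$ is a homogeneous Poisson point process on $\mathbb{R}^2$ of intensity $\mu$ (the intensity of active transmitters), and $\Psi_{\ell 0}$ are i.i.d. $\mathrm{Gamma}\left(\frac{N_I(M)}{M},\frac{\rho}{R(M)M}\right)$ (interference from other nodes), all mutually independent. $\mathrm{Gamma}(v,\vartheta)$ has shape $v$ and scale $\vartheta$; $\rho$ is the transmit SNR, $r_{\mathrm{tr}}$ the transmitter-receiver distance and $\alpha$ the path loss exponent. Let $\mathrm{F}(\beta;\mu)=\Pr(\gamma\le\beta)$ and $\mathrm{F}^{\mathrm{SU}}(\beta)=\Pr(W\le\beta)$. The transmission capacity is $\tilde{\mathrm{c}}_{\mathrm{OSTBC}}(\epsilon)=R(M)\,\mu(\epsilon)(1-\epsilon)$, where $\mu(\epsilon)$ is the inverse of $\epsilon=\mathrm{F}(\beta;\mu)$ with respect to $\mu$. The code rate is the number of symbols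 transmitted per time slot, and $N_I(M)$ is the total number of non-zero elements in the columns of the code matrix containing a given symbol (up to sign and conjugation). $g(N)=\Theta(f(N))$ means $\phi_1f(N)<g(N)<\phi_2f(N)$ as $N\to\infty$, with constants $\phi_1,\phi_2$ independent of $N$. *)

theory Defs
  imports "HOL-Probability.Probability" "HOL-Library.Landau_Symbols"
begin

section \<open>Orthogonal space-time block codes\<close>

text \<open>
  A code matrix has one row per transmit antenna and one column per time slot. Each of its
  elements is \<open>0\<close> or one of \<open>\<plusminus>s\<^sub>k\<close>, \<open>\<plusminus>s\<^sub>k\<^sup>*\<close>.
\<close>

datatype code_entry = Empty | Sym (idx: nat) (negated: bool) (conjugated: bool)

fun entry_val :: "(nat \<Rightarrow> complex) \<Rightarrow> code_entry \<Rightarrow> complex" where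
  "entry_val s Empty = 0"
| "entry_val s (Sym k sg cj) =
     (if sg then - 1 else 1) * (if cj then cnj (s k) else s k)"

record ostbc_code =
  num_symbols :: nat
  num_slots :: nat
  code_entry :: "nat \<Rightarrow> nat \<Rightarrow> code_entry"

text \<open>
  The last conjunct is \<open>X X\<^sup>H = (\<Sum>k. |s\<^sub>k|\<^sup>2) I\<^sub>M\<close>, as an identity in the symbols.
\<close>

definition is_ostbc :: "nat \<Rightarrow> ostbc_code \<Rightarrow> bool" where
  "is_ostbc M C \<longleftrightarrow>
     0 < num_symbols C \<and> 0 < num_slots C \<and>
     (\<forall>i<M. \<forall>t<num_slots C. code_entry C i t \<noteq> Empty \<longrightarrow> idx (code_entry C i t) < num_symbols C) \<and>
     (\<forall>s :: nat \<Rightarrow> complex. \<forall>i<M. \<forall>j<M.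
        (\<Sum>t<num_slots C. entry_val s (code_entry C i t) * cnj (entry_val s (code_entry C j t))) =
        (if i = j then \<Sum>k<num_symbols C. complex_of_real ((cmod (s k))\<^sup>2) else 0))"

definition code_rate :: "ostbc_code \<Rightarrow> real" where
  "code_rate C = real (num_symbols C) / real (num_slots C)"

definition slots_with_symbol :: "nat \<Rightarrow> ostbc_code \<Rightarrow> nat \<Rightarrow> nat set" where
  "slots_with_symbol M C k =
     {t. t < num_slots C \<and> (\<exists>i<M. \<exists>sg cj. code_entry C i t = Sym k sg cj)}"

text \<open>
  The code parameter is a number attached to the code, so the count must not depend on which
  symbol is selected.
\<close>

definition has_code_parameter :: "nat \<Rightarrow> ostbc_code \<Rightarrow> nat \<Rightarrow> bool" where
  "has_code_parameter M C n \<longleftrightarrow>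
     (\<forall>k<num_symbols C.
        (\<Sum>t\<in>slots_with_symbol M C k. card {i. i < M \<and> code_entry C i t \<noteq> Empty}) = n)"


section \<open>Gamma variables and homogeneous Poisson point processes\<close>

definition gamma_density :: "real \<Rightarrow> real \<Rightarrow> real \<Rightarrow> real" where
  "gamma_density v \<theta> x =
     (if 0 < x then x powr (v - 1) * exp (- x / \<theta>) / (Gamma v * \<theta> powr v) else 0)"

definition gamma_distributed :: "'w measure \<Rightarrow> ('w \<Rightarrow> real) \<Rightarrow> real \<Rightarrow> real \<Rightarrow> bool" where
  "gamma_distributed Q Y v \<theta> \<longleftrightarrow> distributed Q lborel Y (\<lambda>x. ennreal (gamma_density v \<theta> x))"

definition point_count :: "(nat \<Rightarrow> 'w \<Rightarrow> real^2) \<Rightarrow> (real^2) set \<Rightarrow> 'w \<Rightarrow> nat" where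
  "point_count X B \<omega> = card {l. X l \<omega> \<in> B}"

text \<open>
  The process is given by an enumeration \<open>X\<^sub>0, X\<^sub>1, \<dots>\<close> of its points, which are almost surely
  infinitely many since the intensity is positive. Almost sure local finiteness is required
  explicitly because \<open>card\<close> vanishes on infinite sets.
\<close>

definition homogeneous_ppp :: "'w measure \<Rightarrow> real \<Rightarrow> (nat \<Rightarrow> 'w \<Rightarrow> real^2) \<Rightarrow> bool" where
  "homogeneous_ppp Q \<mu> X \<longleftrightarrow>
     0 < \<mu> \<and>
     (\<forall>l. X l \<in> borel_measurable Q) \<and>
     (\<forall>B\<in>sets borel. bounded B \<longrightarrow>
        (AE \<omega> in Q. finite {l. X l \<omega> \<in> B}) \<and>
        (\<forall>k. measure Q {\<omega> \<in> space Q. point_count X B \<omega> = k} =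
              (\<mu> * measure lborel B) ^ k / fact k * exp (- (\<mu> * measure lborel B)))) \<and>
     (\<forall>B :: nat \<Rightarrow> (real^2) set.
        (\<forall>i. B i \<in> sets borel \<and> bounded (B i)) \<and> disjoint_family B \<longrightarrow>
        prob_space.indep_vars Q (\<lambda>_. count_space UNIV) (\<lambda>i. point_count X (B i)) UNIV)"


section \<open>The approximate SINR model\<close>

text \<open>
  One realisation carries the signal power, the marks, and for every intensity \<open>\<mu>\<close> the node
  process \<open>nodes S \<mu>\<close>; nothing is said about the joint law for different \<open>\<mu>\<close>.
\<close>

record 'w sinr_model =
  prob_sp :: "'w measure"
  signal :: "'w \<Rightarrow> real"
  marks :: "nat \<Rightarrow> 'w \<Rightarrow> real"
  nodes :: "real \<Rightarrow> nat \<Rightarrow> 'w \<Rightarrow> real^2"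

datatype source = Signal | Nodes | Mark nat

fun source_events :: "'w sinr_model \<Rightarrow> real \<Rightarrow> source \<Rightarrow> 'w set set" where
  "source_events S \<mu> Signal =
     sets (vimage_algebra (space (prob_sp S)) (signal S) borel)"
| "source_events S \<mu> Nodes =
     sets (vimage_algebra (space (prob_sp S)) (\<lambda>\<omega> l. nodes S \<mu> l \<omega>) (PiM UNIV (\<lambda>_. borel)))"
| "source_events S \<mu> (Mark l) =
     sets (vimage_algebra (space (prob_sp S)) (marks S l) borel)"

definition approx_sinr_model ::
  "real \<Rightarrow> real \<Rightarrow> real \<Rightarrow> nat \<Rightarrow> nat \<Rightarrow> real \<Rightarrow> nat \<Rightarrow> 'w sinr_model \<Rightarrow> bool" where
  "approx_sinr_model \<alpha> rtr \<rho> N M R NI S \<longleftrightarrow>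
     prob_space (prob_sp S) \<and>
     gamma_distributed (prob_sp S) (signal S) (real (M * N)) (\<rho> / (R * real M * rtr powr \<alpha>)) \<and>
     (\<forall>l. gamma_distributed (prob_sp S) (marks S l) (real NI / real M) (\<rho> / (R * real M))) \<and>
     (\<forall>\<mu>>0.
        homogeneous_ppp (prob_sp S) \<mu> (nodes S \<mu>) \<and>
        prob_space.indep_sets (prob_sp S) (source_events S \<mu>) UNIV)"

definition sinr :: "real \<Rightarrow> 'w sinr_model \<Rightarrow> real \<Rightarrow> 'w \<Rightarrow> real" where
  "sinr \<alpha> S \<mu> \<omega> =
     signal S \<omega> / ((\<Sum>l. norm (nodes S \<mu> l \<omega>) powr (- \<alpha>) * marks S l \<omega>) + 1)"

definition outage_prob :: "real \<Rightarrow> 'w sinr_model \<Rightarrow> real \<Rightarrow> real \<Rightarrow> real" where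
  "outage_prob \<alpha> S \<beta> \<mu> = measure (prob_sp S) {\<omega> \<in> space (prob_sp S). sinr \<alpha> S \<mu> \<omega> \<le> \<beta>}"

definition outage_prob_SU :: "'w sinr_model \<Rightarrow> real \<Rightarrow> real" where
  "outage_prob_SU S \<beta> = measure (prob_sp S) {\<omega> \<in> space (prob_sp S). signal S \<omega> \<le> \<beta>}"

definition intensity_at_outage :: "real \<Rightarrow> 'w sinr_model \<Rightarrow> real \<Rightarrow> real \<Rightarrow> real" where
  "intensity_at_outage \<alpha> S \<beta> \<epsilon> = the_inv_into {0<..} (\<lambda>\<mu>. outage_prob \<alpha> S \<beta> \<mu>) \<epsilon>"

definition transmission_capacity :: "real \<Rightarrow> real \<Rightarrow> 'w sinr_model \<Rightarrow> real \<Rightarrow> real \<Rightarrow> real" where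
  "transmission_capacity R \<alpha> S \<beta> \<epsilon> = R * intensity_at_outage \<alpha> S \<beta> \<epsilon> * (1 - \<epsilon>)"

definition scaling_factor :: "real \<Rightarrow> real \<Rightarrow> nat \<Rightarrow> nat \<Rightarrow> real" where
  "scaling_factor \<alpha> R NI M =
     R * real M powr (2 / \<alpha>) *
     (Gamma (real NI / real M) / Gamma (real NI / real M + 2 / \<alpha>))"

text \<open>
  The number of transmit antennas as a function of the number \<open>N\<close> of receive antennas. Constant
  functions are included.
\<close>

definition antenna_choice :: "(nat \<Rightarrow> nat) \<Rightarrow> bool" where
  "antenna_choice m \<longleftrightarrow> (\<forall>\<^sub>F N in sequentially. 1 \<le> m N \<and> m N \<le> N)"

end

theory Submission
  imports Defs
begin

text \<open>
  Write \<open>\<delta> = 2 / \<alpha>\<close>, \<open>n = M N\<close>, \<open>v = N\<^sub>I / M\<close>. The Laplace functional of the marked Poisson process shows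
  that the interference has Laplace transform \<open>exp (- \<mu> \<kappa> s\<^sup>\<delta>)\<close> with
  \<open>\<kappa> = \<pi> \<Gamma>(1 - \<delta>) \<theta>\<^sup>\<delta> \<Gamma>(v + \<delta>) / \<Gamma>(v)\<close> and \<open>\<theta>\<close> the scale of the marks, so it is \<open>(\<mu> \<kappa>)\<^sup>1\<^sup>/\<^sup>\<delta>\<close> times one fixed
  stable variable \<open>Z\<close>. As the signal is a scaled Erlang variable \<open>E\<^sub>n\<close>, the outage probability is
  \<open>P(E\<^sub>n \<le> b + t Z)\<close>, where \<open>b\<close> does not depend on \<open>\<mu>\<close> and \<open>t\<close> is proportional to
  \<open>(\<mu> \<Gamma>(v + \<delta>) / \<Gamma>(v))\<^sup>1\<^sup>/\<^sup>\<delta>\<close> with a factor free of \<open>M\<close>, \<open>N\<close> and the code. This is continuous and strictly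
  increasing in \<open>t\<close>. Since \<open>b = o(n)\<close> and \<open>E\<^sub>n\<close> concentrates at \<open>n\<close>, the solution \<open>t\<close> for outage \<open>\<epsilon>\<close> is of
  order \<open>n\<close>, uniformly in \<open>M \<le> N\<close>, which gives the order of \<open>\<mu>\<close>.

  The sublinear growth for arbitrary codes uses \<open>N\<^sub>I \<ge> R M\<^sup>2\<close>, which bounds \<open>g(M)\<close> because
  \<open>\<Gamma>(v) / \<Gamma>(v + \<delta>)\<close> is of order \<open>v\<^sup>-\<^sup>\<delta>\<close>.
\<close>

text \<open>Every pair (N, M) comes with its own probability space, and the stable law is known only
  through its Laplace transform. So a single reference variable \<open>Z\<close> is taken from one
  of the given models, and all models are compared with it by equality in law; this keeps the
  constants free of N, M and the code. The order of \<open>t\<close> rests on 0 < Z < \<infinity>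
  almost surely: finiteness of the interference is the limit s -> 0 of the Laplace transform,
  positivity of \<open>Z\<close> the limit s -> \<infinity>. The noise term b is \<beta> R M
  rtr^\<alpha> / \<rho>, so R \<le> 1 bounds b / (M N) by a constant over N. This bound on the rate
  and the lower bounds on the code parameter are all extracted from the orthogonality identity,
  evaluated at coordinate vectors. The hypothesis on the outage without interference says that the
  law at t = 0 lies below \<epsilon>, so that \<epsilon> is attained at a positive
  intensity.\<close>

section \<open>Orthogonal designs\<close>

text \<open>The orthogonality identity holds for all symbol values. Testing it at coordinate vectors
  turns it into statements about where a symbol stands in the matrix.\<close>

lemma entry_val_single:
  "entry_val (\<lambda>j. if j = k then 1 else 0) e =
     (if e \<noteq> Empty \<and> idx e = k then (if negated e then - 1 else 1) else 0)"
  by (cases e) auto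

lemma is_ostbcD:
  assumes "is_ostbc M C" "i < M" "j < M"
  shows "(\<Sum>t<num_slots C. entry_val s (code_entry C i t) * cnj (entry_val s (code_entry C j t))) =
        (if i = j then \<Sum>k<num_symbols C. complex_of_real ((cmod (s k))\<^sup>2) else 0)"
  using assms unfolding is_ostbc_def by blast

definition symbol_slots :: "ostbc_code \<Rightarrow> nat \<Rightarrow> nat \<Rightarrow> nat set" where
  "symbol_slots C k i = {t. t < num_slots C \<and> code_entry C i t \<noteq> Empty \<and> idx (code_entry C i t) = k}"

text \<open>At the \<open>k\<close>-th coordinate vector every occurrence of symbol \<open>k\<close>
  in row \<open>i\<close> contributes (+-1)^2 = 1 to the diagonal entry of the identity, whose value
  is 1.\<close>

lemma card_symbol_slots:
  assumes C: "is_ostbc M C" and i: "i < M" and k: "k < num_symbols C"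
  shows "card (symbol_slots C k i) = 1"
proof -
  let ?s = "\<lambda>j. if j = k then 1 else (0::complex)"
  have "(\<Sum>t<num_slots C. entry_val ?s (code_entry C i t) * cnj (entry_val ?s (code_entry C i t)))
      = (\<Sum>t<num_slots C. if t \<in> symbol_slots C k i then 1 else 0)"
    by (intro sum.cong) (auto simp: entry_val_single symbol_slots_def)
  also have "\<dots> = of_nat (card (symbol_slots C k i))"
    by (simp add: sum.If_cases symbol_slots_def Int_def lessThan_def)
  finally have 1: "(\<Sum>t<num_slots C. entry_val ?s (code_entry C i t) * cnj (entry_val ?s (code_entry C i t)))
     = of_nat (card (symbol_slots C k i))" .
  have "(\<Sum>j<num_symbols C. complex_of_real ((cmod (?s j))\<^sup>2)) = (\<Sum>j<num_symbols C. if j = k then 1 else 0)"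
    by (intro sum.cong) auto
  also have "\<dots> = 1" using k by (simp add: sum.delta)
  finally have "(of_nat (card (symbol_slots C k i)) :: complex) = 1"
    using 1 is_ostbcD[OF C i i, of ?s] by simp
  then show ?thesis using of_nat_eq_1_iff by blast
qed

text \<open>At the coordinate vector the off-diagonal entry must vanish. As row \<open>i\<close>
  carries the symbol in one slot only, a shared slot would leave a single summand +-1 with nothing
  to cancel it.\<close>

lemma symbol_slots_disjoint:
  assumes C: "is_ostbc M C" and i: "i < M" and j: "j < M" and "i \<noteq> j" and k: "k < num_symbols C"
  shows "symbol_slots C k i \<inter> symbol_slots C k j = {}"
proof (rule ccontr)
  let ?s = "\<lambda>j. if j = k then 1 else (0::complex)"
  let ?f = "\<lambda>t. entry_val ?s (code_entry C i t) * cnj (entry_val ?s (code_entry C j t))"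
  assume "symbol_slots C k i \<inter> symbol_slots C k j \<noteq> {}"
  then obtain u where u: "u \<in> symbol_slots C k i" "u \<in> symbol_slots C k j" by auto
  have only: "symbol_slots C k i = {u}" 
    using card_symbol_slots[OF C i k] u(1) by (metis card_1_singletonE singletonD)
  have un: "u < num_slots C" using u by (simp add: symbol_slots_def)
  have "(\<Sum>t<num_slots C. ?f t) = (\<Sum>t\<in>{u}. ?f t)"
    using un only
    by (intro sum.mono_neutral_right) (auto simp: entry_val_single symbol_slots_def set_eq_iff)
  moreover have "?f u \<noteq> 0" using u by (auto simp: entry_val_single symbol_slots_def)
  ultimately show False using is_ostbcD[OF C i j, of ?s] \<open>i \<noteq> j\<close> by simp
qed

definition column_entries :: "nat \<Rightarrow> ostbc_code \<Rightarrow> nat \<Rightarrow> nat set" where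
  "column_entries M C t = {i. i < M \<and> code_entry C i t \<noteq> Empty}"

definition row_slots :: "ostbc_code \<Rightarrow> nat \<Rightarrow> nat set" where
  "row_slots C i = {t. t < num_slots C \<and> code_entry C i t \<noteq> Empty}"

lemma card_row_slots:
  assumes C: "is_ostbc M C" and i: "i < M"
  shows "card (row_slots C i) = num_symbols C"
proof -
  have "row_slots C i = (\<Union>k<num_symbols C. symbol_slots C k i)"
    using C i unfolding row_slots_def symbol_slots_def is_ostbc_def by blast
  also have "card \<dots> = (\<Sum>k<num_symbols C. card (symbol_slots C k i))"
    by (intro card_UN_disjoint) (auto simp: symbol_slots_def)
  also have "\<dots> = num_symbols C" using card_symbol_slots[OF C i] by simp
  finally show ?thesis .
qed

text \<open>The \<open>num_symbols C\<close> non-zero entries of row 0 sit in distinct slots. The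
  upper bound later makes the noise term small against M N.\<close>

lemma code_rate_bounds:
  assumes C: "is_ostbc M C" and "1 \<le> M"
  shows "0 < code_rate C" "code_rate C \<le> 1"
proof -
  have "card (row_slots C 0) \<le> card {..<num_slots C}"
    by (intro card_mono) (auto simp: row_slots_def)
  then have "num_symbols C \<le> num_slots C" using card_row_slots[OF C, of 0] assms by simp
  moreover have "0 < num_symbols C" "0 < num_slots C" using C by (auto simp: is_ostbc_def)
  ultimately show "0 < code_rate C" "code_rate C \<le> 1" by (simp_all add: code_rate_def)
qed

lemma slots_with_symbol_conv: "slots_with_symbol M C k = (\<Union>i<M. symbol_slots C k i)"
proof -
  have "(\<exists>sg cj. e = Sym k sg cj) \<longleftrightarrow> e \<noteq> Empty \<and> idx e = k" for e
    by (cases e) auto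
  then show ?thesis unfolding slots_with_symbol_def symbol_slots_def by auto
qed

text \<open>
  Every symbol occurs once in each row, and no two rows carry it in the same column. Counting
  the triples \<open>(k, t, i)\<close> with \<open>s\<^sub>k\<close> in column \<open>t\<close> and a non-zero entry at \<open>(i, t)\<close> therefore
  gives \<open>K N\<^sub>I = (\<Sum>t. n\<^sub>t\<^sup>2)\<close>, while \<open>(\<Sum>t. n\<^sub>t) = K M\<close>; conclude by Cauchy-Schwarz.
\<close>

lemma code_parameter_ge:
  assumes C: "is_ostbc M C" and P: "has_code_parameter M C n"
  shows "code_rate C * (real M)\<^sup>2 \<le> real n"
proof -
  define K T where "K = num_symbols C" and "T = num_slots C"
  define w where "w t = card (column_entries M C t)" for t
  have K: "0 < K" and T: "0 < T" using C by (auto simp: is_ostbc_def K_def T_def)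
  \<comment> \<open>Double counting of the non-zero positions with column weight \<open>g\<close>:
    weight 1 gives the total M K, weight \<open>w\<close> the sum of squares.\<close>
  have sum_w: "(\<Sum>t<T. g t * w t) = (\<Sum>i<M. \<Sum>t\<in>row_slots C i. g t)" for g :: "nat \<Rightarrow> nat"
  proof -
    have "(\<Sum>t<T. g t * w t) = (\<Sum>t<T. \<Sum>i\<in>{i\<in>{..<M}. code_entry C i t \<noteq> Empty}. g t)"
      by (simp add: w_def column_entries_def mult.commute)
    also have "\<dots> = (\<Sum>i<M. \<Sum>t\<in>{t\<in>{..<T}. code_entry C i t \<noteq> Empty}. g t)"
      by (rule sum.swap_restrict) auto
    also have "\<dots> = (\<Sum>i<M. \<Sum>t\<in>row_slots C i. g t)"
      by (simp add: row_slots_def T_def)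
    finally show ?thesis .
  qed
  have "(\<Sum>t<T. w t) = (\<Sum>i<M. card (row_slots C i))"
    using sum_w[of "\<lambda>_. 1"] by simp
  also have "\<dots> = M * K" using card_row_slots[OF C] by (simp add: K_def)
  finally have s1: "(\<Sum>t<T. w t) = M * K" .
  have "K * n = (\<Sum>k<K. \<Sum>t\<in>slots_with_symbol M C k. w t)"
    using P unfolding has_code_parameter_def K_def w_def column_entries_def by simp
  also have "\<dots> = (\<Sum>k<K. \<Sum>i<M. \<Sum>t\<in>symbol_slots C k i. w t)"
    unfolding slots_with_symbol_conv using symbol_slots_disjoint[OF C]
    by (intro sum.cong refl sum.UNION_disjoint) (auto simp: K_def symbol_slots_def)
  also have "\<dots> = (\<Sum>i<M. \<Sum>k<K. \<Sum>t\<in>symbol_slots C k i. w t)"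
    by (rule sum.swap)
  also have "\<dots> = (\<Sum>i<M. \<Sum>t\<in>row_slots C i. w t)"
  proof (rule sum.cong[OF refl])
    fix i assume i: "i \<in> {..<M}"
    then have r: "row_slots C i = (\<Union>k<K. symbol_slots C k i)"
      using C unfolding row_slots_def symbol_slots_def is_ostbc_def K_def by blast
    show "(\<Sum>k<K. \<Sum>t\<in>symbol_slots C k i. w t) = (\<Sum>t\<in>row_slots C i. w t)"
      unfolding r by (intro sum.UNION_disjoint[symmetric]) (auto simp: symbol_slots_def)
  qed
  also have "\<dots> = (\<Sum>t<T. w t * w t)" by (rule sum_w[symmetric])
  finally have s2: "K * n = (\<Sum>t<T. w t * w t)" .
  have "(\<Sum>t<T. real (w t) * 1)\<^sup>2 \<le> (\<Sum>t<T. (real (w t))\<^sup>2) * (\<Sum>t<T. 1\<^sup>2)"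
    by (rule Cauchy_Schwarz_ineq_sum)
  moreover have "(\<Sum>t<T. real (w t) * 1) = real (M * K)" unfolding s1[symmetric] by simp
  moreover have "(\<Sum>t<T. (real (w t))\<^sup>2) = real (K * n)" unfolding s2 by (simp add: power2_eq_square)
  ultimately have "(real M * real K)\<^sup>2 \<le> real K * real n * real T" by simp
  then have "real K * (real K * (real M)\<^sup>2) \<le> real K * (real n * real T)"
    by (simp add: power2_eq_square algebra_simps)
  then have "real K * (real M)\<^sup>2 \<le> real n * real T" using K by simp
  then show ?thesis using T by (simp add: code_rate_def K_def[symmetric] T_def[symmetric] field_simps)
qed

text \<open>Symbol 0 stands in \<open>M\<close> different columns, one for each row, and each of
  these has a non-zero entry. The mark shape \<open>NI / M\<close> is thus at least 1, the range
  covered by \<open>inverse_Gamma_ratio_bounds\<close>.\<close>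

lemma code_parameter_ge_antennas:
  assumes C: "is_ostbc M C" and P: "has_code_parameter M C n"
  shows "M \<le> n"
proof -
  have k: "0 < num_symbols C" using C by (simp add: is_ostbc_def)
  have "M = (\<Sum>i<M. \<Sum>t\<in>symbol_slots C 0 i. 1)"
    using card_symbol_slots[OF C _ k] by simp
  also have "\<dots> \<le> (\<Sum>i<M. \<Sum>t\<in>symbol_slots C 0 i. card {i. i < M \<and> code_entry C i t \<noteq> Empty})"
  proof (intro sum_mono)
    fix i t assume "i \<in> {..<M}" "t \<in> symbol_slots C 0 i"
    then have "{i. i < M \<and> code_entry C i t \<noteq> Empty} \<noteq> {}" by (auto simp: symbol_slots_def)
    then show "1 \<le> card {i. i < M \<and> code_entry C i t \<noteq> Empty}"
      by (simp add: Suc_le_eq card_gt_0_iff)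
  qed
  also have "\<dots> = (\<Sum>t\<in>slots_with_symbol M C 0. card {i. i < M \<and> code_entry C i t \<noteq> Empty})"
    unfolding slots_with_symbol_conv using symbol_slots_disjoint[OF C _ _ _ k]
    by (intro sum.UNION_disjoint[symmetric]) (auto simp: symbol_slots_def)
  also have "\<dots> = n" using P k by (simp add: has_code_parameter_def)
  finally show ?thesis .
qed

section \<open>Ratios of Gamma values\<close>

lemma Gamma_real_plus1: "0 < v \<Longrightarrow> Gamma (v + 1) = v * Gamma (v::real)"
  by (rule Gamma_plus1) auto

lemma Gamma_log_convex:
  fixes x y u :: real
  assumes "0 < x" "0 < y" "0 \<le> u" "u \<le> 1"
  shows "Gamma ((1 - u) * x + u * y) \<le> Gamma x powr (1 - u) * Gamma y powr u"
proof -
  have z: "0 < (1 - u) * x + u * y"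
    using assms by (cases "u = 0") (auto intro!: add_nonneg_pos mult_pos_pos mult_nonneg_nonneg)
  have "(ln \<circ> Gamma) ((1 - u) *\<^sub>R x + u *\<^sub>R y) \<le> (1 - u) * (ln \<circ> Gamma) x + u * (ln \<circ> Gamma) y"
    using assms by (intro convex_onD[OF log_convex_Gamma_real]) auto
  then have "ln (Gamma ((1 - u) * x + u * y)) \<le> ln (Gamma x powr (1 - u) * Gamma y powr u)"
    using assms by (simp add: ln_mult ln_powr Gamma_real_pos less_imp_neq[OF Gamma_real_pos, symmetric])
  moreover have "0 < Gamma x" "0 < Gamma y" "0 < Gamma ((1 - u) * x + u * y)"
    using assms z by (auto intro!: Gamma_real_pos)
  ultimately show ?thesis by (subst (asm) ln_le_cancel_iff) auto
qed

text \<open>Wendel's inequalities. Log-convexity is applied twice: \<open>v + d\<close> lies between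
  \<open>v\<close> and \<open>v + 1\<close>, and \<open>v + 1\<close> lies between
  \<open>v + d\<close> and \<open>v + d + 1\<close>; the functional equation removes the shift by
  1.\<close>

lemma Gamma_ratio_bounds:
  fixes v d :: real
  assumes v: "0 < v" and d: "0 < d" "d < 1"
  shows "Gamma (v + d) / Gamma v \<le> v powr d" "v * (v + d) powr (d - 1) \<le> Gamma (v + d) / Gamma v"
proof -
  have g: "0 < Gamma v" "0 < Gamma (v + d)" using v d by (auto intro!: Gamma_real_pos)
  have "Gamma (v + d) = Gamma ((1 - d) * v + d * (v + 1))" by (simp add: algebra_simps)
  also have "\<dots> \<le> Gamma v powr (1 - d) * Gamma (v + 1) powr d"
    using v d by (intro Gamma_log_convex) auto
  also have "\<dots> = Gamma v powr ((1 - d) + d) * v powr d"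
    using v d g unfolding powr_add by (subst Gamma_real_plus1) (auto simp: powr_mult)
  also have "\<dots> = Gamma v * v powr d" using g by simp
  finally show "Gamma (v + d) / Gamma v \<le> v powr d" using g by (simp add: field_simps)
  have "v * Gamma v = Gamma (v + 1)" using v by (simp add: Gamma_real_plus1)
  also have "\<dots> = Gamma ((1 - (1 - d)) * (v + d) + (1 - d) * (v + d + 1))" by (simp add: algebra_simps)
  also have "\<dots> \<le> Gamma (v + d) powr (1 - (1 - d)) * Gamma (v + d + 1) powr (1 - d)"
    using v d by (intro Gamma_log_convex) auto
  also have "\<dots> = Gamma (v + d) powr d * ((v + d) powr (1 - d) * Gamma (v + d) powr (1 - d))"
    using v d g by (subst Gamma_real_plus1) (auto simp: powr_mult)
  also have "\<dots> = Gamma (v + d) powr (d + (1 - d)) * (v + d) powr (1 - d)"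
    unfolding powr_add by (simp only: mult_ac)
  also have "\<dots> = Gamma (v + d) * (v + d) powr (1 - d)" using g by simp
  finally have "v * Gamma v \<le> Gamma (v + d) * (v + d) powr (1 - d)" .
  then have "v * Gamma v * (v + d) powr (d - 1)
      \<le> Gamma (v + d) * (v + d) powr (1 - d) * (v + d) powr (d - 1)"
    by (rule mult_right_mono) simp
  also have "\<dots> = Gamma (v + d)"
    using v d by (simp add: mult.assoc powr_add[symmetric])
  finally show "v * (v + d) powr (d - 1) \<le> Gamma (v + d) / Gamma v"
    using g by (simp add: field_simps)
qed

text \<open>The factor 1/2 arises from \<open>v + d \<le> 2 * v\<close> together with
  \<open>2 powr (d - 1) \<ge> 1 / 2\<close>.\<close>

lemma Gamma_ratio_ge:
  fixes v d :: real
  assumes v: "1 \<le> v" and d: "0 < d" "d < 1"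
  shows "v powr d / 2 \<le> Gamma (v + d) / Gamma v"
proof -
  have "(2 * v) powr (d - 1) \<le> (v + d) powr (d - 1)"
    using v d by (intro powr_mono2') auto
  moreover have "(1 / 2) * v powr (d - 1) \<le> (2 * v) powr (d - 1)"
  proof -
    have "(2::real) powr (-1) \<le> 2 powr (d - 1)" using d by (intro powr_mono) auto
    then show ?thesis using v by (simp add: powr_mult powr_minus)
  qed
  ultimately have "v * ((1 / 2) * v powr (d - 1)) \<le> v * (v + d) powr (d - 1)"
    using v by (intro mult_left_mono) auto
  moreover have "v * ((1 / 2) * v powr (d - 1)) = v powr d / 2"
    using v by (simp add: powr_diff)
  ultimately show ?thesis using Gamma_ratio_bounds(2)[of v d] v d by linarith
qed

section \<open>The Laplace functional of a Poisson process\<close>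

text \<open>The function e^(-x) on [0, \<infinity>]. With sums and integrals in
  \<open>ennreal\<close>, the Laplace functional can be stated before anything is known about
  convergence of the interference.\<close>

definition exp_neg :: "ennreal \<Rightarrow> ennreal" where
  "exp_neg x = (if x = \<top> then 0 else ennreal (exp (- enn2real x)))"

text \<open>Inverse of \<open>exp_neg\<close> on [0, 1]. It presents any factor with values in
  [0, 1], zero included, as \<open>exp_neg f\<close>, so that the Laplace functional covers products
  of such factors over the points.\<close>

definition ln_neg :: "ennreal \<Rightarrow> ennreal" where
  "ln_neg p = (if p = 0 then \<top> else ennreal (- ln (enn2real p)))"

lemma exp_neg_ennreal: "0 \<le> r \<Longrightarrow> exp_neg (ennreal r) = ennreal (exp (- r))"
  by (simp add: exp_neg_def)

lemma exp_neg_top [simp]: "exp_neg \<top> = 0" and exp_neg_0 [simp]: "exp_neg 0 = 1"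
  by (simp_all add: exp_neg_def)

lemma exp_neg_le_1: "exp_neg x \<le> 1"
  by (simp add: exp_neg_def)

lemma exp_neg_less_top: "exp_neg x < \<top>"
  by (simp add: exp_neg_def)

lemma exp_neg_measurable [measurable]: "exp_neg \<in> borel_measurable borel"
  unfolding exp_neg_def[abs_def] by measurable

lemma ln_neg_measurable [measurable]: "ln_neg \<in> borel_measurable borel"
  unfolding ln_neg_def[abs_def] by measurable

lemma exp_neg_ln_neg: "p \<le> 1 \<Longrightarrow> exp_neg (ln_neg p) = p"
proof (cases p)
  case (real r)
  assume "p \<le> 1"
  then have "r \<le> 1" using real by simp
  then show ?thesis using real by (cases "r = 0") (auto simp: ln_neg_def exp_neg_ennreal)
qed (auto simp: top_unique)

lemma exp_neg_add: "exp_neg (x + y) = exp_neg x * exp_neg y"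
  by (cases x; cases y)
     (auto simp: exp_neg_ennreal ennreal_plus[symmetric] ennreal_mult[symmetric] exp_add[symmetric]
       simp del: ennreal_plus)

lemma exp_neg_sum: "exp_neg (\<Sum>i\<in>A. f i) = (\<Prod>i\<in>A. exp_neg (f i))"
  by (induction A rule: infinite_finite_induct) (simp_all add: exp_neg_add)

lemma exp_neg_mult_of_nat: "exp_neg (x * of_nat k) = exp_neg x ^ k"
  by (induction k) (simp_all add: exp_neg_add algebra_simps)

text \<open>The infinite limit is a genuine case, since neither the sum over the points nor the
  integral over the plane has to be finite.\<close>

lemma exp_neg_tendsto:
  assumes f: "(f \<longlongrightarrow> x) F"
  shows "((\<lambda>i. exp_neg (f i)) \<longlongrightarrow> exp_neg x) F"
proof (cases x)
  case (real r)
  then have "eventually (\<lambda>i. f i < \<top>) F" using f by (intro order_tendstoD) auto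
  then have "eventually (\<lambda>i. ennreal (exp (- enn2real (f i))) = exp_neg (f i)) F"
    by eventually_elim (auto simp: exp_neg_def)
  moreover have "((\<lambda>i. ennreal (exp (- enn2real (f i)))) \<longlongrightarrow> ennreal (exp (- r))) F"
    using f real by (intro tendsto_ennrealI tendsto_exp tendsto_minus tendsto_enn2real) auto
  ultimately have "((\<lambda>i. exp_neg (f i)) \<longlongrightarrow> ennreal (exp (- r))) F"
    by (rule Lim_transform_eventually[rotated])
  then show ?thesis using real by (simp add: exp_neg_ennreal)
next
  case top
  have "((\<lambda>i. exp_neg (f i)) \<longlongrightarrow> 0) F"
  proof (rule order_tendstoI)
    fix a :: ennreal assume a: "0 < a"
    then obtain e where e: "0 < e" "ennreal e \<le> a"
      by (cases a) (auto intro: that[of 1])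
    have "eventually (\<lambda>i. ennreal (max 0 (- ln e)) < f i) F"
      using f top by (intro order_tendstoD) auto
    then show "eventually (\<lambda>i. exp_neg (f i) < a) F"
    proof eventually_elim
      case (elim i)
      show ?case
      proof (cases "f i")
        case (real r)
        then have "max 0 (- ln e) < r" using elim[unfolded real(2)] by (subst (asm) ennreal_less_iff) auto
        then have "exp (- r) < exp (ln e)" by simp
        then have "ennreal (exp (- r)) < ennreal e" using e by (simp add: ennreal_lessI)
        then show ?thesis using e(2) real by (simp add: exp_neg_ennreal)
      qed (use a in simp)
    qed
  qed auto
  then show ?thesis using top by simp
qed

lemma exp_neg_suminf: "(\<lambda>n. \<Prod>i<n. exp_neg (f i)) \<longlonglongrightarrow> exp_neg (\<Sum>i. f i)"
  unfolding exp_neg_sum[symmetric] by (intro exp_neg_tendsto summable_LIMSEQ) auto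

text \<open>A function equal to \<open>h\<close> on a set with \<open>N\<close> points contributes
  \<open>p ^ N\<close> with \<open>p = exp_neg h\<close> to the Laplace functional;
  \<open>h = \<top>\<close> is the case \<open>p = 0\<close>.\<close>

lemma poisson_generating_function:
  assumes P: "prob_space Q" and N: "N \<in> measurable Q (count_space UNIV)"
    and dist: "\<And>k. measure Q {\<omega> \<in> space Q. N \<omega> = (k::nat)} = r ^ k / fact k * exp (- r)"
    and r: "0 \<le> r" and p: "p \<le> 1"
  shows "(\<integral>\<^sup>+\<omega>. p ^ N \<omega> \<partial>Q) = exp_neg (ennreal r * (1 - p))"
proof -
  interpret prob_space Q by fact
  obtain q where q: "p = ennreal q" "0 \<le> q" "q \<le> 1"
    using p by (cases p) (auto simp: ennreal_le_1 top_unique)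
  have "(\<integral>\<^sup>+\<omega>. p ^ N \<omega> \<partial>Q) = (\<integral>\<^sup>+k. p ^ k \<partial>distr Q (count_space UNIV) N)"
    using N by (simp add: nn_integral_distr)
  also have "distr Q (count_space UNIV) N = density (count_space UNIV) (\<lambda>k. ennreal (r ^ k / fact k * exp (- r)))"
  proof (rule measure_eqI_countable[where A=UNIV])
    fix k :: nat
    show "emeasure (distr Q (count_space UNIV) N) {k} =
        emeasure (density (count_space UNIV) (\<lambda>k. ennreal (r ^ k / fact k * exp (- r)))) {k}"
      using dist[of k] N
      by (simp add: emeasure_distr emeasure_density emeasure_eq_measure vimage_def Int_def conj_commute)
  qed auto
  also have "(\<integral>\<^sup>+k. p ^ k \<partial>density (count_space UNIV) (\<lambda>k. ennreal (r ^ k / fact k * exp (- r))))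
     = (\<integral>\<^sup>+k. ennreal ((q * r) ^ k / fact k * exp (- r)) \<partial>count_space UNIV)"
    using q r by (subst nn_integral_density)
      (auto intro!: nn_integral_cong simp: ennreal_power ennreal_mult[symmetric] power_mult_distrib field_simps)
  also have "\<dots> = (\<Sum>k. ennreal ((q * r) ^ k / fact k * exp (- r)))"
    by (rule nn_integral_count_space_nat)
  also have "\<dots> = ennreal (exp (q * r) * exp (- r))"
  proof -
    have "(\<lambda>k. (q * r) ^ k / fact k * exp (- r)) sums (exp (q * r) * exp (- r))"
      using exp_converges[of "q * r"] by (intro sums_mult2) (simp add: field_simps)
    then show ?thesis using q r
      by (subst suminf_ennreal2) (auto simp: sums_iff)
  qed
  also have "exp (q * r) * exp (- r) = exp (- (r * (1 - q)))"
    by (simp add: exp_add[symmetric] algebra_simps)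
  also have "ennreal (exp (- (r * (1 - q)))) = exp_neg (ennreal r * (1 - p))"
  proof -
    have "1 - p = ennreal (1 - q)" using q by (simp add: ennreal_minus[symmetric])
    then have "ennreal r * (1 - p) = ennreal (r * (1 - q))" using r q by (simp add: ennreal_mult)
    then show ?thesis using r q by (simp add: exp_neg_ennreal)
  qed
  finally show ?thesis .
qed

lemma homogeneous_pppD:
  assumes "homogeneous_ppp Q \<mu> X"
  shows "0 < \<mu>" "\<And>l. X l \<in> borel_measurable Q"
    "\<And>B. B \<in> sets borel \<Longrightarrow> bounded B \<Longrightarrow> AE \<omega> in Q. finite {l. X l \<omega> \<in> B}"
    "\<And>B k. B \<in> sets borel \<Longrightarrow> bounded B \<Longrightarrow> measure Q {\<omega> \<in> space Q. point_count X B \<omega> = k} =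
              (\<mu> * measure lborel B) ^ k / fact k * exp (- (\<mu> * measure lborel B))"
    "\<And>B :: nat \<Rightarrow> _. (\<And>i. B i \<in> sets borel) \<Longrightarrow> (\<And>i. bounded (B i)) \<Longrightarrow> disjoint_family B \<Longrightarrow>
        prob_space.indep_vars Q (\<lambda>_. count_space UNIV) (\<lambda>i. point_count X (B i)) UNIV"
  using assms unfolding homogeneous_ppp_def by blast+

lemma suminf_indicator_eq_card:
  assumes "finite {l::nat. x l \<in> B}"
  shows "(\<Sum>l. indicator B (x l) :: ennreal) = of_nat (card {l. x l \<in> B})"
proof -
  have "(\<Sum>l. indicator B (x l) :: ennreal) = (\<Sum>l\<in>{l. x l \<in> B}. indicator B (x l))"
    by (rule suminf_finite[OF assms]) auto
  then show ?thesis by simp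
qed

text \<open>On the level sets of the non-zero values, the sum over the points is a weighted sum of
  independent Poisson counts, so the expectation factorises into generating functions. Bounded
  support keeps the level sets among the bounded sets that \<open>homogeneous_ppp\<close> speaks
  about.\<close>

lemma ppp_laplace_simple:
  assumes P: "prob_space Q" and X: "homogeneous_ppp Q \<mu> X"
    and f: "simple_function borel f" and bd: "\<And>x. r \<le> norm x \<Longrightarrow> f x = 0"
  shows "(\<integral>\<^sup>+\<omega>. exp_neg (\<Sum>l. f (X l \<omega>)) \<partial>Q) = exp_neg (ennreal \<mu> * (\<integral>\<^sup>+x. 1 - exp_neg (f x) \<partial>lborel))"
proof -
  interpret prob_space Q by fact
  note X = homogeneous_pppD[OF X]
  note [measurable] = X(2)
  have fin: "finite (range f - {0})" using simple_functionD(1)[OF f] by simp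
  obtain h where h: "bij_betw h {..<card (range f - {0})} (range f - {0})"
    using ex_bij_betw_nat_finite[OF fin] by (auto simp: atLeast0LessThan)
  define n where "n = card (range f - {0})"
  \<comment> \<open>Independence is given for sequences of disjoint sets; the finitely many level
    sets are padded with empty ones.\<close>
  define B where "B i = (if i < n then f -` {h i} else {})" for i
  have hn: "h i \<in> range f - {0}" if "i < n" for i
    using h that by (auto simp: bij_betw_def n_def)
  have hinj: "inj_on h {..<n}" using h by (auto simp: bij_betw_def n_def)
  have Bm [measurable]: "B i \<in> sets borel" for i
    using simple_functionD(2)[OF f] by (auto simp: B_def)
  have Bb: "bounded (B i)" for i
  proof (rule bounded_subset[of "ball 0 r"])
    show "B i \<subseteq> ball 0 r"
    proof
      fix x assume "x \<in> B i"
      then have "f x \<noteq> 0" using hn[of i] by (auto simp: B_def split: if_splits)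
      then have "\<not> r \<le> norm x" using bd by blast
      then show "x \<in> ball 0 r" by simp
    qed
  qed simp
  have Bd: "disjoint_family B"
    using hinj by (auto simp: disjoint_family_on_def B_def inj_on_def)
  \<comment> \<open>The general \<open>g\<close> serves both \<open>f\<close> itself and
    \<open>1 - exp_neg f\<close>.\<close>
  have sum_B: "g (f x) = (\<Sum>i<n. g (h i) * indicator (B i) x)" if "g 0 = 0" for g :: "ennreal \<Rightarrow> ennreal" and x
  proof (cases "f x = 0")
    case True
    then have "x \<notin> B i" for i using hn[of i] by (auto simp: B_def)
    then show ?thesis using True that by simp
  next
    case False
    then have "f x \<in> h ` {..<n}" using h by (simp add: bij_betw_def n_def)
    then obtain i where i: "i < n" "h i = f x" by auto
    have "indicator (B j) x = (if j = i then 1 else 0 :: ennreal)" if "j < n" for j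
      using that i hinj by (auto simp: B_def inj_on_def indicator_def)
    then have "(\<Sum>j<n. g (h j) * indicator (B j) x) = (\<Sum>j<n. if j = i then g (h j) else 0)"
      by (intro sum.cong) auto
    then show ?thesis using i by simp
  qed
  define N where "N i = point_count X (B i)" for i
  have ind: "indep_vars (\<lambda>_. count_space UNIV) N UNIV"
    unfolding N_def by (rule X(5)[OF Bm Bb Bd])
  have Nm [measurable]: "N i \<in> measurable Q (count_space UNIV)" for i
    using ind by (auto simp: indep_vars_def)
  have "(\<integral>\<^sup>+\<omega>. exp_neg (\<Sum>l. f (X l \<omega>)) \<partial>Q) = (\<integral>\<^sup>+\<omega>. (\<Prod>i<n. exp_neg (h i) ^ N i \<omega>) \<partial>Q)"
  proof (rule nn_integral_cong_AE)
    have "AE \<omega> in Q. \<forall>i. finite {l. X l \<omega> \<in> B i}"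
      unfolding AE_all_countable using X(3)[OF Bm Bb] by blast
    then show "AE \<omega> in Q. exp_neg (\<Sum>l. f (X l \<omega>)) = (\<Prod>i<n. exp_neg (h i) ^ N i \<omega>)"
    proof eventually_elim
      case (elim \<omega>)
      have "(\<Sum>l. f (X l \<omega>)) = (\<Sum>l. \<Sum>i<n. h i * indicator (B i) (X l \<omega>))"
        using sum_B[of "\<lambda>y. y"] by simp
      also have "\<dots> = (\<Sum>i<n. \<Sum>l. h i * indicator (B i) (X l \<omega>))"
        by (rule suminf_sum) auto
      also have "\<dots> = (\<Sum>i<n. h i * of_nat (N i \<omega>))"
        using elim by (simp add: suminf_indicator_eq_card N_def point_count_def)
      finally show ?case by (simp add: exp_neg_sum exp_neg_mult_of_nat)
    qed
  qed
  also have "\<dots> = (\<Prod>i<n. \<integral>\<^sup>+\<omega>. exp_neg (h i) ^ N i \<omega> \<partial>Q)"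
  proof (rule indep_vars_nn_integral)
    show "indep_vars (\<lambda>_. borel) (\<lambda>i \<omega>. exp_neg (h i) ^ N i \<omega>) {..<n}"
      by (rule indep_vars_compose2[OF indep_vars_subset[OF ind]]) auto
  qed auto
  also have "\<dots> = (\<Prod>i<n. exp_neg (ennreal (\<mu> * measure lborel (B i)) * (1 - exp_neg (h i))))"
    using X(1) X(4)[OF Bm Bb] by (intro prod.cong poisson_generating_function P refl)
      (auto simp: exp_neg_le_1 N_def[symmetric])
  also have "\<dots> = exp_neg (ennreal \<mu> * (\<Sum>i<n. (1 - exp_neg (h i)) * emeasure lborel (B i)))"
  proof -
    have "emeasure lborel (B i) = ennreal (measure lborel (B i))" for i
      using emeasure_bounded_finite[OF Bb[of i]] by (simp add: emeasure_eq_ennreal_measure less_top)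
    then show ?thesis using X(1)
      by (simp add: exp_neg_sum[symmetric] sum_distrib_left ennreal_mult mult_ac)
  qed
  also have "(\<Sum>i<n. (1 - exp_neg (h i)) * emeasure lborel (B i))
      = (\<integral>\<^sup>+x. (\<Sum>i<n. (1 - exp_neg (h i)) * indicator (B i) x) \<partial>lborel)"
    by (subst nn_integral_sum) (auto intro!: sum.cong simp: nn_integral_cmult)
  also have "\<dots> = (\<integral>\<^sup>+x. 1 - exp_neg (f x) \<partial>lborel)"
    using sum_B[of "\<lambda>y. 1 - exp_neg y"] by simp
  finally show ?thesis .
qed

text \<open>Simple functions increase to \<open>f\<close>; cutting them to growing balls gives
  bounded support and keeps the monotone limit. The left side passes to the limit by domination by
  1, the right side by monotone convergence, as its integral may be infinite.\<close>

theorem ppp_laplace: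
  assumes P: "prob_space Q" and X: "homogeneous_ppp Q \<mu> X" and f [measurable]: "f \<in> borel_measurable borel"
  shows "(\<integral>\<^sup>+\<omega>. exp_neg (\<Sum>l. f (X l \<omega>)) \<partial>Q) = exp_neg (ennreal \<mu> * (\<integral>\<^sup>+x. 1 - exp_neg (f x) \<partial>lborel))"
proof -
  interpret prob_space Q by fact
  have [measurable]: "X l \<in> borel_measurable Q" for l using homogeneous_pppD(2)[OF X] .
  obtain F where F: "\<And>i. simple_function borel (F i)" "incseq F" "\<And>i x. F i x < \<top>" "\<And>x. (SUP i. F i x) = f x"
    using borel_measurable_implies_simple_function_sequence'[OF f] by blast
  define G where "G i x = F i x * indicator (ball 0 (real i)) x" for i x
  have G1: "simple_function borel (G i)" for i
    unfolding G_def by (intro simple_function_mult F(1) simple_function_indicator) auto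
  have [measurable]: "G i \<in> borel_measurable borel" for i
    using G1 by (rule borel_measurable_simple_function)
  have G2: "incseq (\<lambda>i. G i x)" for x
    unfolding G_def incseq_def using F(2)
    by (intro allI impI mult_mono) (auto simp: incseq_def le_fun_def indicator_def)
  have G3: "(\<lambda>i. G i x) \<longlonglongrightarrow> f x" for x
  proof -
    obtain k where "norm x < real k" using reals_Archimedean2 by blast
    then have "eventually (\<lambda>i. F i x = G i x) sequentially"
      unfolding eventually_sequentially by (intro exI[of _ k]) (auto simp: G_def indicator_def)
    moreover have "(\<lambda>i. F i x) \<longlonglongrightarrow> f x"
      using F(2) unfolding F(4)[symmetric] by (intro LIMSEQ_SUP) (auto simp: incseq_def le_fun_def)
    ultimately show ?thesis by (rule Lim_transform_eventually[rotated])
  qed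
  have Gsup: "(SUP i. G i x) = f x" for x
    using LIMSEQ_SUP[OF G2] G3 by (rule LIMSEQ_unique)
  have 1: "(\<lambda>i. \<integral>\<^sup>+\<omega>. exp_neg (\<Sum>l. G i (X l \<omega>)) \<partial>Q) \<longlonglongrightarrow> (\<integral>\<^sup>+\<omega>. exp_neg (\<Sum>l. f (X l \<omega>)) \<partial>Q)"
  proof (rule nn_integral_dominated_convergence[where w="\<lambda>_. 1"])
    have "(\<lambda>i. exp_neg (\<Sum>l. G i (X l \<omega>))) \<longlonglongrightarrow> exp_neg (\<Sum>l. f (X l \<omega>))" for \<omega>
    proof -
      have "incseq (\<lambda>i. \<Sum>l. G i (X l \<omega>))"
        using G2 by (auto simp: incseq_def intro!: suminf_le)
      then have "(\<lambda>i. \<Sum>l. G i (X l \<omega>)) \<longlonglongrightarrow> (SUP i. \<Sum>l. G i (X l \<omega>))"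
        by (rule LIMSEQ_SUP)
      also have "(SUP i. \<Sum>l. G i (X l \<omega>)) = (\<Sum>l. f (X l \<omega>))"
        using G2 by (subst ennreal_suminf_SUP_eq[symmetric]) (auto simp: Gsup)
      finally show ?thesis by (rule exp_neg_tendsto)
    qed
    then show "AE \<omega> in Q. (\<lambda>i. exp_neg (\<Sum>l. G i (X l \<omega>))) \<longlonglongrightarrow> exp_neg (\<Sum>l. f (X l \<omega>))" by simp
  qed (auto simp: exp_neg_le_1 emeasure_space_1)
  have 2: "(\<lambda>i. \<integral>\<^sup>+x. 1 - exp_neg (G i x) \<partial>lborel) \<longlonglongrightarrow> (\<integral>\<^sup>+x. 1 - exp_neg (f x) \<partial>lborel)"
  proof (rule nn_integral_LIMSEQ)
    have anti: "exp_neg b \<le> exp_neg a" if "a \<le> b" for a b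
      using that by (cases a; cases b) (auto simp: exp_neg_ennreal top_unique)
    show "incseq (\<lambda>i x. 1 - exp_neg (G i x))"
      using G2 by (auto simp: incseq_def le_fun_def intro!: ennreal_minus_mono anti)
    show "(\<lambda>i. 1 - exp_neg (G i x)) \<longlonglongrightarrow> 1 - exp_neg (f x)" for x
      by (intro tendsto_diff_ennreal tendsto_const exp_neg_tendsto G3)
         (auto simp: exp_neg_less_top[THEN less_imp_neq])
  qed auto
  have "(\<lambda>i. exp_neg (ennreal \<mu> * (\<integral>\<^sup>+x. 1 - exp_neg (G i x) \<partial>lborel)))
      \<longlonglongrightarrow> exp_neg (ennreal \<mu> * (\<integral>\<^sup>+x. 1 - exp_neg (f x) \<partial>lborel))"
    by (intro exp_neg_tendsto ennreal_tendsto_cmult 2) auto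
  moreover have "(\<integral>\<^sup>+\<omega>. exp_neg (\<Sum>l. G i (X l \<omega>)) \<partial>Q) = exp_neg (ennreal \<mu> * (\<integral>\<^sup>+x. 1 - exp_neg (G i x) \<partial>lborel))" for i
    by (rule ppp_laplace_simple[OF P X G1, of "real i"]) (auto simp: G_def)
  ultimately show ?thesis using 1 by (simp add: LIMSEQ_unique)
qed

section \<open>Independent marks\<close>

text \<open>One intensity is fixed, and the law of the marks is an arbitrary
  \<open>\<Gamma>\<close>; the Gamma density enters only in \<open>gamma_sources\<close>.\<close>

locale sinr_sources =
  fixes S :: "'w sinr_model" and \<mu> :: real and \<Gamma> :: "real measure"
  assumes prob_space_S: "prob_space (prob_sp S)"
    and ppp_S: "homogeneous_ppp (prob_sp S) \<mu> (nodes S \<mu>)"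
    and signal_S: "signal S \<in> borel_measurable (prob_sp S)"
    and marks_S: "\<And>l. marks S l \<in> borel_measurable (prob_sp S)"
    and distr_marks_S: "\<And>l. distr (prob_sp S) borel (marks S l) = \<Gamma>"
    and indep_S: "prob_space.indep_sets (prob_sp S) (source_events S \<mu>) UNIV"
begin

abbreviation "Q \<equiv> prob_sp S"
abbreviation "X \<equiv> nodes S \<mu>"
abbreviation "Y \<equiv> marks S"
abbreviation "W \<equiv> signal S"

sublocale prob_space Q by (rule prob_space_S)

lemma nodes_measurable: "X l \<in> borel_measurable Q"
  using homogeneous_pppD(2)[OF ppp_S] .

lemmas [measurable] = signal_S marks_S nodes_measurable

definition other_sources :: "source \<Rightarrow> 'w measure" where
  "other_sources i = sigma (space Q) (\<Union>k\<in>-{i}. source_events S \<mu> k)"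

lemma source_events_sub: "source_events S \<mu> k \<subseteq> Pow (space Q)"
  by (cases k) (simp_all add: sets.space_closed[of "vimage_algebra (space Q) _ _", simplified])

lemma sets_other_sources:
  "sets (other_sources i) = sigma_sets (space Q) (\<Union>k\<in>-{i}. source_events S \<mu> k)"
  unfolding other_sources_def using source_events_sub by (intro sets_measure_of) blast

lemma space_other_sources [simp]: "space (other_sources i) = space Q"
  unfolding other_sources_def using source_events_sub by (intro space_measure_of) blast

lemma measurable_other_sources:
  assumes f: "f \<in> measurable (vimage_algebra (space Q) g N) N'" and "k \<noteq> i"
    and eq: "source_events S \<mu> k = sets (vimage_algebra (space Q) g N)"
  shows "f \<in> measurable (other_sources i) N'"
proof (rule measurableI)
  show "f x \<in> space N'" if "x \<in> space (other_sources i)" for x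
    using measurable_space[OF f] that by simp
  fix A assume "A \<in> sets N'"
  then have "f -` A \<inter> space Q \<in> source_events S \<mu> k"
    using measurable_sets[OF f] eq by simp
  then show "f -` A \<inter> space (other_sources i) \<in> sets (other_sources i)"
    using \<open>k \<noteq> i\<close> unfolding sets_other_sources by (auto intro!: sigma_sets.Basic)
qed

lemma nodes_other_sources: "i \<noteq> Nodes \<Longrightarrow> X l \<in> borel_measurable (other_sources i)"
proof -
  assume i: "i \<noteq> Nodes"
  have "(\<lambda>\<omega> l. X l \<omega>) \<in> measurable (vimage_algebra (space Q) (\<lambda>\<omega> l. X l \<omega>) (PiM UNIV (\<lambda>_. borel))) (PiM UNIV (\<lambda>_. borel))"
    by (rule measurable_vimage_algebra1) (auto simp: space_PiM)
  then have "(\<lambda>\<omega>. (\<lambda>\<omega> l. X l \<omega>) \<omega> l) \<in> measurable (vimage_algebra (space Q) (\<lambda>\<omega> l. X l \<omega>) (PiM UNIV (\<lambda>_. borel))) borel"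
    by (rule measurable_compose[OF _ measurable_component_singleton]) simp
  then show ?thesis using i by (intro measurable_other_sources[of "X l" _ _ borel Nodes]) auto
qed

lemma marks_other_sources: "i \<noteq> Mark l \<Longrightarrow> Y l \<in> borel_measurable (other_sources i)"
  by (rule measurable_other_sources[OF measurable_vimage_algebra1, of _ borel "Mark l"]) auto

text \<open>Mutual independence of the sources, grouped into the blocks \<open>-{i}\<close> and
  \<open>{i}\<close>.\<close>

lemma indep_set_source:
  "indep_set (sets (other_sources i)) (source_events S \<mu> i)"
proof -
  have "indep_sets (\<lambda>j. sigma_sets (space Q) (\<Union>k\<in>case_bool (-{i}) {i} j. source_events S \<mu> k)) UNIV"
  proof (rule indep_sets_collect_sigma)
    show "indep_sets (source_events S \<mu>) (\<Union>j. case_bool (-{i}) {i} j)"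
      using indep_S by (rule indep_sets_mono_index[rotated]) simp
    show "Int_stable (source_events S \<mu> k)" for k
      by (cases k) (auto simp: Int_stable_def)
    show "disjoint_family (case_bool (- {i}) {i})"
      by (auto simp: disjoint_family_on_def split: bool.splits)
  qed
  then show ?thesis
    unfolding indep_set_def
    by (rule indep_sets_mono_sets) (auto split: bool.split simp: sets_other_sources intro!: sigma_sets.Basic)
qed

text \<open>The joint law of \<open>V\<close> and \<open>Z\<close> is a product measure, so Tonelli
  integrates out \<open>Z\<close> with \<open>V\<close> frozen. This is applied to each mark in
  turn, and to the signal against the interference.\<close>

lemma nn_integral_source:
  assumes V: "V \<in> measurable (other_sources i) MV"
    and Z [measurable]: "Z \<in> measurable Q MZ"
    and Z': "\<And>A. A \<in> sets MZ \<Longrightarrow> Z -` A \<inter> space Q \<in> source_events S \<mu> i"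
    and G [measurable]: "G \<in> borel_measurable (MV \<Otimes>\<^sub>M MZ)"
  shows "(\<integral>\<^sup>+\<omega>. G (V \<omega>, Z \<omega>) \<partial>Q) = (\<integral>\<^sup>+\<omega>. (\<integral>\<^sup>+\<omega>'. G (V \<omega>, Z \<omega>') \<partial>Q) \<partial>Q)"
proof -
  have ev: "sets (other_sources i) \<subseteq> events" using indep_set_source[of i] by (simp add: indep_sets2_eq)
  have V' [measurable]: "V \<in> measurable Q MV"
    using measurable_sets[OF V] measurable_space[OF V] ev by (intro measurableI) auto
  interpret V: prob_space "distr Q MV V" by (rule prob_space_distr) simp
  interpret Z: prob_space "distr Q MZ Z" by (rule prob_space_distr) simp
  have eq: "distr Q MV V \<Otimes>\<^sub>M distr Q MZ Z = distr Q (MV \<Otimes>\<^sub>M MZ) (\<lambda>x. (V x, Z x))"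
  proof (rule pair_measure_eqI)
    fix A B assume "A \<in> sets (distr Q MV V)" "B \<in> sets (distr Q MZ Z)"
    then have [measurable]: "A \<in> sets MV" "B \<in> sets MZ" by auto
    have "(\<lambda>x. (V x, Z x)) -` (A \<times> B) \<inter> space Q = (V -` A \<inter> space Q) \<inter> (Z -` B \<inter> space Q)"
      by auto
    moreover have "prob ((V -` A \<inter> space Q) \<inter> (Z -` B \<inter> space Q)) = prob (V -` A \<inter> space Q) * prob (Z -` B \<inter> space Q)"
      using measurable_sets[OF V, of A] Z'[of B] by (intro indep_setD[OF indep_set_source[of i]]) auto
    ultimately show "emeasure (distr Q MV V) A * emeasure (distr Q MZ Z) B
        = emeasure (distr Q (MV \<Otimes>\<^sub>M MZ) (\<lambda>x. (V x, Z x))) (A \<times> B)"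
      by (simp add: emeasure_distr emeasure_eq_measure ennreal_mult)
  qed (auto simp: V.sigma_finite_measure_axioms Z.sigma_finite_measure_axioms)
  have "(\<integral>\<^sup>+\<omega>. G (V \<omega>, Z \<omega>) \<partial>Q) = (\<integral>\<^sup>+p. G p \<partial>distr Q (MV \<Otimes>\<^sub>M MZ) (\<lambda>x. (V x, Z x)))"
    by (simp add: nn_integral_distr)
  also have "\<dots> = (\<integral>\<^sup>+v. \<integral>\<^sup>+z. G (v, z) \<partial>distr Q MZ Z \<partial>distr Q MV V)"
    unfolding eq[symmetric] by (rule Z.nn_integral_fst[symmetric]) simp
  also have "\<dots> = (\<integral>\<^sup>+\<omega>. (\<integral>\<^sup>+z. G (V \<omega>, z) \<partial>distr Q MZ Z) \<partial>Q)"
    by (subst nn_integral_distr) auto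
  also have "\<dots> = (\<integral>\<^sup>+\<omega>. (\<integral>\<^sup>+\<omega>'. G (V \<omega>, Z \<omega>') \<partial>Q) \<partial>Q)"
    by (intro nn_integral_cong nn_integral_distr) (auto intro!: measurable_Pair2[of _ MV] dest: measurable_space[OF V'])
  finally show ?thesis .
qed

lemma sets_Gamma [measurable_cong]: "sets \<Gamma> = sets borel"
  using distr_marks_S[of 0] by (metis sets_distr)

lemma prob_space_Gamma: "prob_space \<Gamma>"
  using prob_space_distr[OF marks_S] distr_marks_S by metis

lemma nn_integral_marks:
  "g \<in> borel_measurable borel \<Longrightarrow> (\<integral>\<^sup>+\<omega>. g (Y l \<omega>) \<partial>Q) = (\<integral>\<^sup>+y. g y \<partial>\<Gamma>)"
  by (simp add: distr_marks_S[of l, symmetric] nn_integral_distr)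

text \<open>
  The marks are integrated out one at a time: \<open>D j\<close> is the product with the first \<open>j\<close> marks
  already averaged.
\<close>

lemma marking_prod:
  assumes G [measurable]: "G \<in> borel_measurable (borel \<Otimes>\<^sub>M borel)"
  shows "(\<integral>\<^sup>+\<omega>. (\<Prod>l<n. G (X l \<omega>, Y l \<omega>)) \<partial>Q) = (\<integral>\<^sup>+\<omega>. (\<Prod>l<n. \<integral>\<^sup>+y. G (X l \<omega>, y) \<partial>\<Gamma>) \<partial>Q)"
proof -
  interpret \<Gamma>: prob_space \<Gamma> by (rule prob_space_Gamma)
  define H where "H x = (\<integral>\<^sup>+y. G (x, y) \<partial>\<Gamma>)" for x
  have H [measurable]: "H \<in> borel_measurable borel" unfolding H_def[abs_def] by measurable
  define D where "D j l \<omega> = (if l < j then H (X l \<omega>) else G (X l \<omega>, Y l \<omega>))" for j l \<omega>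
  have "j \<le> n \<Longrightarrow> (\<integral>\<^sup>+\<omega>. (\<Prod>l<n. G (X l \<omega>, Y l \<omega>)) \<partial>Q) = (\<integral>\<^sup>+\<omega>. (\<Prod>l<n. D j l \<omega>) \<partial>Q)" for j
  proof (induction j)
    case 0
    then show ?case by (simp add: D_def)
  next
    case (Suc j)
    \<comment> \<open>The factors other than the \<open>j\<close>-th depend on the nodes and on
      other marks only, so \<open>Mark j\<close> can be integrated out against them.\<close>
    define Z where "Z \<omega> = (\<Prod>l\<in>{..<n}-{j}. D j l \<omega>)" for \<omega>
    have [measurable]: "X l \<in> borel_measurable (other_sources (Mark j))" for l
      by (rule nodes_other_sources) simp
    have Dm: "D j l \<in> borel_measurable (other_sources (Mark j))" if "l \<noteq> j" for l
    proof -
      have [measurable]: "Y l \<in> borel_measurable (other_sources (Mark j))"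
        using that by (intro marks_other_sources) auto
      show ?thesis unfolding D_def[abs_def] by measurable
    qed
    have [measurable]: "Z \<in> borel_measurable (other_sources (Mark j))"
      unfolding Z_def[abs_def] by (intro borel_measurable_prod_ennreal Dm) auto
    have "(\<integral>\<^sup>+\<omega>. (\<Prod>l<n. D j l \<omega>) \<partial>Q) = (\<integral>\<^sup>+\<omega>. Z \<omega> * G (X j \<omega>, Y j \<omega>) \<partial>Q)"
      using Suc.prems by (intro nn_integral_cong) (auto simp: Z_def prod.remove[of "{..<n}" j] D_def mult.commute)
    also have "\<dots> = (\<integral>\<^sup>+\<omega>. (\<integral>\<^sup>+\<omega>'. Z \<omega> * G (X j \<omega>, Y j \<omega>') \<partial>Q) \<partial>Q)"
      using nn_integral_source[of "\<lambda>\<omega>. (Z \<omega>, X j \<omega>)" "Mark j" "borel \<Otimes>\<^sub>M borel" "Y j" borel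
          "\<lambda>p. fst (fst p) * G (snd (fst p), snd p)"]
      by (simp add: in_vimage_algebra)
    also have "\<dots> = (\<integral>\<^sup>+\<omega>. Z \<omega> * H (X j \<omega>) \<partial>Q)"
      by (intro nn_integral_cong) (simp add: nn_integral_cmult H_def nn_integral_marks[symmetric, of _ j])
    also have "\<dots> = (\<integral>\<^sup>+\<omega>. (\<Prod>l<n. D (Suc j) l \<omega>) \<partial>Q)"
      using Suc.prems
      by (intro nn_integral_cong)
        (auto simp: Z_def prod.remove[of "{..<n}" j] D_def mult.commute less_Suc_eq intro!: arg_cong2[where f="(*)"] prod.cong)
    finally show ?case using Suc by simp
  qed
  from this[of n] show ?thesis by (simp add: D_def H_def)
qed

text \<open>Averaging over the marks replaces the factor of a point at \<open>x\<close> by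
  \<open>H x\<close>, the mean of \<open>exp_neg (a (x, y))\<close>. Written as
  \<open>exp_neg (ln_neg (H x))\<close>, it falls under \<open>ppp_laplace\<close>.
  \<open>marking_prod\<close> handles finitely many points, and the passage to all of them is
  dominated by 1.\<close>

lemma marked_laplace:
  assumes a [measurable]: "a \<in> borel_measurable (borel \<Otimes>\<^sub>M borel)"
  shows "(\<integral>\<^sup>+\<omega>. exp_neg (\<Sum>l. a (X l \<omega>, Y l \<omega>)) \<partial>Q)
       = exp_neg (ennreal \<mu> * (\<integral>\<^sup>+y. \<integral>\<^sup>+x. 1 - exp_neg (a (x, y)) \<partial>lborel \<partial>\<Gamma>))"
proof -
  interpret \<Gamma>: prob_space \<Gamma> by (rule prob_space_Gamma)
  define H where "H x = (\<integral>\<^sup>+y. exp_neg (a (x, y)) \<partial>\<Gamma>)" for x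
  have H [measurable]: "H \<in> borel_measurable borel" unfolding H_def[abs_def] by measurable
  have H1: "H x \<le> 1" for x
  proof -
    have "H x \<le> (\<integral>\<^sup>+y. 1 \<partial>\<Gamma>)" unfolding H_def by (intro nn_integral_mono exp_neg_le_1)
    then show ?thesis by (simp add: \<Gamma>.emeasure_space_1)
  qed
  have lim: "(\<lambda>n. \<integral>\<^sup>+\<omega>. (\<Prod>l<n. exp_neg (b l \<omega>)) \<partial>Q) \<longlonglongrightarrow> (\<integral>\<^sup>+\<omega>. exp_neg (\<Sum>l. b l \<omega>) \<partial>Q)"
    if [measurable]: "\<And>l. b l \<in> borel_measurable Q" for b :: "nat \<Rightarrow> 'w \<Rightarrow> ennreal"
  proof (rule nn_integral_dominated_convergence[where w="\<lambda>_. 1"])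
    show "AE \<omega> in Q. (\<lambda>n. \<Prod>l<n. exp_neg (b l \<omega>)) \<longlonglongrightarrow> exp_neg (\<Sum>l. b l \<omega>)"
      by (simp add: exp_neg_suminf)
    show "AE \<omega> in Q. (\<Prod>l<n. exp_neg (b l \<omega>)) \<le> 1" for n
      unfolding exp_neg_sum[symmetric] by (simp add: exp_neg_le_1)
  qed (auto simp: emeasure_space_1)
  have "(\<lambda>n. \<integral>\<^sup>+\<omega>. (\<Prod>l<n. H (X l \<omega>)) \<partial>Q) \<longlonglongrightarrow> (\<integral>\<^sup>+\<omega>. exp_neg (\<Sum>l. ln_neg (H (X l \<omega>))) \<partial>Q)"
    using lim[of "\<lambda>l \<omega>. ln_neg (H (X l \<omega>))"] by (simp add: exp_neg_ln_neg[OF H1])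
  moreover have "(\<lambda>n. \<integral>\<^sup>+\<omega>. (\<Prod>l<n. H (X l \<omega>)) \<partial>Q) \<longlonglongrightarrow> (\<integral>\<^sup>+\<omega>. exp_neg (\<Sum>l. a (X l \<omega>, Y l \<omega>)) \<partial>Q)"
    using lim[of "\<lambda>l \<omega>. a (X l \<omega>, Y l \<omega>)"] by (simp add: marking_prod[of "\<lambda>p. exp_neg (a p)"] H_def)
  ultimately have "(\<integral>\<^sup>+\<omega>. exp_neg (\<Sum>l. a (X l \<omega>, Y l \<omega>)) \<partial>Q) = (\<integral>\<^sup>+\<omega>. exp_neg (\<Sum>l. ln_neg (H (X l \<omega>))) \<partial>Q)"
    by (rule LIMSEQ_unique[rotated])
  also have "\<dots> = exp_neg (ennreal \<mu> * (\<integral>\<^sup>+x. 1 - H x \<partial>lborel))"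
    using ppp_laplace[OF prob_space_S ppp_S, of "\<lambda>x. ln_neg (H x)"] by (simp add: exp_neg_ln_neg[OF H1])
  also have "(\<integral>\<^sup>+x. 1 - H x \<partial>lborel) = (\<integral>\<^sup>+x. \<integral>\<^sup>+y. 1 - exp_neg (a (x, y)) \<partial>\<Gamma> \<partial>lborel)"
  proof (intro nn_integral_cong)
    fix x
    have "(\<integral>\<^sup>+y. 1 - exp_neg (a (x, y)) \<partial>\<Gamma>) = (\<integral>\<^sup>+y. 1 \<partial>\<Gamma>) - H x"
      unfolding H_def using H1[of x]
      by (intro nn_integral_diff) (auto simp: exp_neg_le_1 H_def top_unique)
    then show "1 - H x = (\<integral>\<^sup>+y. 1 - exp_neg (a (x, y)) \<partial>\<Gamma>)" by (simp add: \<Gamma>.emeasure_space_1)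
  qed
  also have "\<dots> = (\<integral>\<^sup>+y. \<integral>\<^sup>+x. 1 - exp_neg (a (x, y)) \<partial>lborel \<partial>\<Gamma>)"
  proof -
    interpret pair_sigma_finite "lborel :: (real^2) measure" \<Gamma> ..
    show ?thesis using Fubini[of "\<lambda>p. 1 - exp_neg (a p)"] by simp
  qed
  finally show ?thesis .
qed

end

section \<open>The interference is a stable variable\<close>

lemma gamma_density_measurable [measurable]: "gamma_density v \<theta> \<in> borel_measurable borel"
  unfolding gamma_density_def[abs_def] by measurable

lemma gamma_density_nonneg: "0 < v \<Longrightarrow> 0 \<le> gamma_density v \<theta> x"
  by (auto simp: gamma_density_def intro!: divide_nonneg_nonneg mult_nonneg_nonneg less_imp_le[OF Gamma_real_pos])

lemma nn_integral_gamma_density: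
  assumes "0 < v" "0 < \<theta>"
  shows "(\<integral>\<^sup>+x. ennreal (gamma_density v \<theta> x) \<partial>lborel) = 1"
proof -
  have G: "0 < Gamma v" "Gamma v \<noteq> 0" using Gamma_real_pos[OF assms(1)] by simp_all
  have "ennreal (Gamma v) = \<bar>1 / \<theta>\<bar> * (\<integral>\<^sup>+x. ennreal (indicator {0..} (0 + 1 / \<theta> * x) * (0 + 1 / \<theta> * x) powr (v - 1) / exp (0 + 1 / \<theta> * x)) \<partial>lborel)"
    unfolding Gamma_conv_nn_integral_real[OF assms(1)] using assms
    by (intro nn_integral_real_affine) auto
  also have "\<dots> = (\<integral>\<^sup>+x. ennreal (Gamma v * gamma_density v \<theta> x) \<partial>lborel)"
    using assms G
    by (subst nn_integral_cmult[symmetric])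
      (auto intro!: nn_integral_cong simp: ennreal_mult[symmetric] gamma_density_def indicator_def
         powr_divide powr_diff exp_minus field_simps zero_le_divide_iff G(2))
  also have "\<dots> = ennreal (Gamma v) * (\<integral>\<^sup>+x. ennreal (gamma_density v \<theta> x) \<partial>lborel)"
    using G assms by (subst nn_integral_cmult[symmetric]) (auto simp: ennreal_mult gamma_density_nonneg)
  finally have "ennreal (Gamma v) * 1 = ennreal (Gamma v) * (\<integral>\<^sup>+x. ennreal (gamma_density v \<theta> x) \<partial>lborel)"
    by simp
  then show ?thesis using G by (subst (asm) ennreal_mult_cancel_left) auto
qed

text \<open>\<open>x powr d\<close> times the density of shape \<open>v\<close> is a constant
  multiple of the density of shape \<open>v + d\<close>.\<close>

lemma nn_integral_gamma_powr:
  assumes "0 < v" "0 < \<theta>" "0 \<le> d"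
  shows "(\<integral>\<^sup>+x. ennreal (x powr d) \<partial>density lborel (\<lambda>x. ennreal (gamma_density v \<theta> x)))
    = ennreal (\<theta> powr d * (Gamma (v + d) / Gamma v))"
proof -
  have G: "0 < Gamma v" "0 < Gamma (v + d)" "Gamma v \<noteq> 0" "Gamma (d + v) \<noteq> 0"
    using Gamma_real_pos[of v, OF assms(1)] Gamma_real_pos[of "v + d"] assms
    by (simp_all only: add.commute[of d v] less_imp_neq[THEN not_sym] add_pos_nonneg not_False_eq_True)
  have "(\<integral>\<^sup>+x. ennreal (x powr d) \<partial>density lborel (\<lambda>x. ennreal (gamma_density v \<theta> x)))
     = (\<integral>\<^sup>+x. ennreal (\<theta> powr d * (Gamma (v + d) / Gamma v)) * ennreal (gamma_density (v + d) \<theta> x) \<partial>lborel)"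
    using assms G
    by (subst nn_integral_density)
      (auto intro!: nn_integral_cong simp: ennreal_mult[symmetric] gamma_density_nonneg gamma_density_def
        powr_add powr_diff field_simps G(3,4))
  also have "\<dots> = ennreal (\<theta> powr d * (Gamma (v + d) / Gamma v))"
    using assms by (subst nn_integral_cmult) (auto simp: nn_integral_gamma_density)
  finally show ?thesis .
qed

lemma erlang_CDF_measurable [measurable]: "erlang_CDF k l \<in> borel_measurable borel"
  unfolding erlang_CDF_def[abs_def] by measurable

text \<open>\<open>erlang_density\<close> counts its index from 0, hence \<open>n - 1\<close>. The
  two densities agree off the origin, a null set.\<close>

lemma gamma_distributed_iff_erlang:
  assumes "0 < n" "0 < \<theta>"
  shows "gamma_distributed Q Z (real n) \<theta> \<longleftrightarrow> distributed Q lborel Z (\<lambda>x. ennreal (erlang_density (n - 1) (1 / \<theta>) x))"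
  unfolding gamma_distributed_def
proof (rule distributed_cong_density)
  have "gamma_density (real n) \<theta> x = erlang_density (n - 1) (1 / \<theta>) x" if "x \<noteq> 0" for x
    using assms that Gamma_fact[of "n - 1", where ?'a=real]
    by (auto simp: gamma_density_def erlang_density_def powr_realpow[symmetric] powr_diff of_nat_diff field_simps)
  moreover have "AE x in lborel. x \<noteq> (0::real)" by (rule AE_lborel_singleton)
  ultimately show "AE x in lborel. ennreal (gamma_density (real n) \<theta> x) = ennreal (erlang_density (n - 1) (1 / \<theta>) x)"
    by auto
qed auto

text \<open>Layer cake: \<open>1 - exp (- u)\<close> is the integral of \<open>exp (- t)\<close>
  over [0, u]. After exchanging the integrals, the points x with c |x|^(-\<alpha>) \<ge> t form a
  disc of area \<pi> (c / t)^(2/\<alpha>), and the remaining integral over t is \<Gamma>(1 -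
  2/\<alpha>), finite because \<alpha> > 2.\<close>

lemma nn_integral_path_loss:
  assumes \<alpha>: "2 < \<alpha>" and c: "0 \<le> c"
  shows "(\<integral>\<^sup>+x. 1 - exp_neg (ennreal (c * norm (x::real^2) powr (- \<alpha>))) \<partial>lborel)
      = ennreal (pi * Gamma (1 - 2 / \<alpha>) * c powr (2 / \<alpha>))"
proof (cases "c = 0")
  case False
  then have c: "0 < c" using c by simp
  have layer: "1 - exp_neg (ennreal u) = (\<integral>\<^sup>+t. ennreal (exp (- t)) * indicator {0..u} t \<partial>lborel)" if "0 \<le> u" for u
  proof -
    have "(\<integral>\<^sup>+t. ennreal (exp (- t)) * indicator {0..u} t \<partial>lborel) = ennreal (- exp (- u) - (- exp (- 0)))"
      by (rule nn_integral_FTC_Icc) (auto intro!: derivative_eq_intros that)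
    then show ?thesis using that by (simp add: exp_neg_ennreal ennreal_minus[symmetric])
  qed
  have vol: "(\<integral>\<^sup>+x. indicator {0..c * norm (x::real^2) powr (- \<alpha>)} t \<partial>lborel) = ennreal (pi * (c / t) powr (2 / \<alpha>))"
    if "0 < t" for t
  proof -
    have iff: "t \<le> c * norm (x::real^2) powr (- \<alpha>) \<longleftrightarrow> norm x \<le> (c / t) powr (1 / \<alpha>)" if "x \<noteq> 0" for x
    proof -
      have "t \<le> c * norm (x::real^2) powr (- \<alpha>) \<longleftrightarrow> norm x powr \<alpha> \<le> c / t"
        using \<open>0 < t\<close> that by (simp add: powr_minus field_simps)
      also have "\<dots> \<longleftrightarrow> norm x powr \<alpha> \<le> ((c / t) powr (1 / \<alpha>)) powr \<alpha>"
        using \<alpha> c \<open>0 < t\<close> by (simp add: powr_powr)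
      also have "\<dots> \<longleftrightarrow> norm x \<le> (c / t) powr (1 / \<alpha>)"
        using \<alpha> powr_mono2[of \<alpha> "norm x"] powr_less_mono2[of \<alpha> _ "norm x"] by (force simp: not_less[symmetric])
      finally show ?thesis .
    qed
    have "(\<integral>\<^sup>+x. indicator {0..c * norm (x::real^2) powr (- \<alpha>)} t \<partial>lborel)
        = (\<integral>\<^sup>+x. indicator (cball (0::real^2) ((c / t) powr (1 / \<alpha>))) x \<partial>lborel)"
    proof (rule nn_integral_cong_AE)
      \<comment> \<open>Since \<open>0 powr (- \<alpha>) = 0\<close> in HOL, the origin lies in the
        disc but not in the level set; it is a null set.\<close>
      have "AE x in lborel. x \<noteq> (0::real^2)" by (rule AE_lborel_singleton)
      then show "AE x in lborel. (indicator {0..c * norm (x::real^2) powr (- \<alpha>)} t :: ennreal)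
          = indicator (cball (0::real^2) ((c / t) powr (1 / \<alpha>))) x"
        by eventually_elim (use iff that in \<open>auto simp: indicator_def\<close>)
    qed
    also have "\<dots> = ennreal (pi * ((c / t) powr (1 / \<alpha>)) ^ 2)"
      by (simp add: emeasure_cball unit_ball_vol_2)
    also have "((c / t) powr (1 / \<alpha>)) ^ 2 = (c / t) powr (2 / \<alpha>)"
      by (simp add: power2_eq_square powr_add[symmetric])
    finally show ?thesis .
  qed
  have "(\<integral>\<^sup>+x. 1 - exp_neg (ennreal (c * norm (x::real^2) powr (- \<alpha>))) \<partial>lborel)
     = (\<integral>\<^sup>+x. \<integral>\<^sup>+t. ennreal (exp (- t)) * indicator {0..c * norm (x::real^2) powr (- \<alpha>)} t \<partial>lborel \<partial>lborel)"
    using c by (intro nn_integral_cong layer) auto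
  also have "\<dots> = (\<integral>\<^sup>+t. \<integral>\<^sup>+x. ennreal (exp (- t)) * indicator {0..c * norm (x::real^2) powr (- \<alpha>)} t \<partial>lborel \<partial>lborel)"
  proof (rule lborel_pair.Fubini'[symmetric])
    show "(\<lambda>(x::real^2, t). ennreal (exp (- t)) * indicator {0..c * norm (x::real^2) powr (- \<alpha>)} t) \<in> borel_measurable (lborel \<Otimes>\<^sub>M lborel)"
      unfolding indicator_def atLeastAtMost_iff by measurable
  qed
  also have "\<dots> = (\<integral>\<^sup>+t. ennreal (pi * c powr (2 / \<alpha>)) * ennreal (indicator {0..} t * t powr ((1 - 2 / \<alpha>) - 1) / exp t) \<partial>lborel)"
  proof (rule nn_integral_cong_AE)
    have "AE t in lborel. t \<noteq> (0::real)" by (rule AE_lborel_singleton)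
    then show "AE t in lborel. (\<integral>\<^sup>+x. ennreal (exp (- t)) * indicator {0..c * norm (x::real^2) powr (- \<alpha>)} t \<partial>lborel)
      = ennreal (pi * c powr (2 / \<alpha>)) * ennreal (indicator {0..} t * t powr ((1 - 2 / \<alpha>) - 1) / exp t)"
    proof eventually_elim
      case (elim t)
      show ?case
      proof (cases "0 < t")
        case True
        have "(\<integral>\<^sup>+x. ennreal (exp (- t)) * indicator {0..c * norm (x::real^2) powr (- \<alpha>)} t \<partial>lborel)
            = ennreal (exp (- t)) * (\<integral>\<^sup>+x. indicator {0..c * norm (x::real^2) powr (- \<alpha>)} t \<partial>lborel)"
          by (rule nn_integral_cmult) (unfold indicator_def atLeastAtMost_iff, measurable)
        also have "\<dots> = ennreal (exp (- t)) * ennreal (pi * (c / t) powr (2 / \<alpha>))"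
          unfolding vol[OF True] ..
        finally show ?thesis using c True
          by (simp add: ennreal_mult[symmetric] powr_divide exp_minus powr_minus field_simps)
      next
        case False
        then show ?thesis using elim by simp
      qed
    qed
  qed
  also have "\<dots> = ennreal (pi * c powr (2 / \<alpha>)) * ennreal (Gamma (1 - 2 / \<alpha>))"
    using \<alpha> by (subst nn_integral_cmult) (auto simp: Gamma_conv_nn_integral_real)
  also have "\<dots> = ennreal (pi * Gamma (1 - 2 / \<alpha>) * c powr (2 / \<alpha>))"
    using \<alpha> by (subst ennreal_mult[symmetric]) (auto intro!: less_imp_le[OF Gamma_real_pos] simp: mult_ac)
  finally show ?thesis .
qed simp

locale gamma_sources = sinr_sources S \<mu> "density lborel (\<lambda>x. ennreal (gamma_density v \<theta> x))"
  for S :: "'w sinr_model" and \<mu> v \<theta> :: real +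
  fixes \<alpha> :: real
  assumes \<alpha>: "2 < \<alpha>" and v: "0 < v" and \<theta>: "0 < \<theta>"
begin

text \<open>A real series, whose value is meaningful only where it converges;
  \<open>interference_AE\<close> shows that this is almost everywhere.\<close>

definition interference :: "'w \<Rightarrow> real" where
  "interference \<omega> = (\<Sum>l. norm (X l \<omega>) powr (- \<alpha>) * Y l \<omega>)"

definition kap :: real where
  "kap = pi * Gamma (1 - 2 / \<alpha>) * \<theta> powr (2 / \<alpha>) * (Gamma (v + 2 / \<alpha>) / Gamma v)"

lemma mu_pos: "0 < \<mu>" using homogeneous_pppD(1)[OF ppp_S] .

lemma kap_pos: "0 < kap"
  unfolding kap_def using \<alpha> v \<theta> by (intro mult_pos_pos divide_pos_pos Gamma_real_pos) (auto intro: add_pos_pos)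

text \<open>In \<open>marked_laplace\<close> for s y |x|^(-\<alpha>), the integral over the plane is
  \<open>nn_integral_path_loss\<close> with \<open>c = s * y\<close>, and the mark enters through
  its moment of order 2/\<alpha>. The sum stays in \<open>ennreal\<close>, since this formula is
  what yields its convergence.\<close>

lemma ennreal_interference_laplace:
  assumes s: "0 < s"
  shows "(\<integral>\<^sup>+\<omega>. exp_neg (ennreal s * (\<Sum>l. ennreal (norm (X l \<omega>) powr (- \<alpha>) * Y l \<omega>))) \<partial>Q)
     = ennreal (exp (- (\<mu> * kap * s powr (2 / \<alpha>))))"
proof -
  let ?\<Gamma> = "density lborel (\<lambda>x. ennreal (gamma_density v \<theta> x))"
  have "(\<integral>\<^sup>+\<omega>. exp_neg (ennreal s * (\<Sum>l. ennreal (norm (X l \<omega>) powr (- \<alpha>) * Y l \<omega>))) \<partial>Q)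
      = (\<integral>\<^sup>+\<omega>. exp_neg (\<Sum>l. ennreal (s * snd (X l \<omega>, Y l \<omega>) * norm (fst (X l \<omega>, Y l \<omega>)) powr (- \<alpha>))) \<partial>Q)"
    using s by (subst ennreal_suminf_cmult[symmetric]) (simp add: ennreal_mult'[symmetric] mult_ac)
  also have "\<dots> = exp_neg (ennreal \<mu> * (\<integral>\<^sup>+y. \<integral>\<^sup>+x. 1 - exp_neg (ennreal (s * y * norm (x::real^2) powr (- \<alpha>))) \<partial>lborel \<partial>?\<Gamma>))"
    by (subst marked_laplace) auto
  also have "(\<integral>\<^sup>+y. \<integral>\<^sup>+x. 1 - exp_neg (ennreal (s * y * norm (x::real^2) powr (- \<alpha>))) \<partial>lborel \<partial>?\<Gamma>)
     = (\<integral>\<^sup>+y. ennreal (pi * Gamma (1 - 2 / \<alpha>) * s powr (2 / \<alpha>)) * ennreal (y powr (2 / \<alpha>)) \<partial>?\<Gamma>)"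
  proof (rule nn_integral_cong_AE)
    have "AE y in ?\<Gamma>. 0 < y" by (subst AE_density) (auto simp: gamma_density_def)
    then show "AE y in ?\<Gamma>. (\<integral>\<^sup>+x. 1 - exp_neg (ennreal (s * y * norm (x::real^2) powr (- \<alpha>))) \<partial>lborel)
       = ennreal (pi * Gamma (1 - 2 / \<alpha>) * s powr (2 / \<alpha>)) * ennreal (y powr (2 / \<alpha>))"
    proof eventually_elim
      case (elim y)
      have "0 \<le> Gamma (1 - 2 / \<alpha>)" using \<alpha> by (intro less_imp_le[OF Gamma_real_pos]) auto
      then show ?case
        using \<alpha> s elim by (subst nn_integral_path_loss) (auto simp: ennreal_mult[symmetric] powr_mult mult_ac)
    qed
  qed
  also have "\<dots> = ennreal (pi * Gamma (1 - 2 / \<alpha>) * s powr (2 / \<alpha>)) * ennreal (\<theta> powr (2 / \<alpha>) * (Gamma (v + 2 / \<alpha>) / Gamma v))"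
    using v \<theta> \<alpha> by (subst nn_integral_cmult) (auto simp: nn_integral_gamma_powr)
  also have "\<dots> = ennreal (kap * s powr (2 / \<alpha>))"
  proof -
    have "0 \<le> Gamma (1 - 2 / \<alpha>)" "0 \<le> Gamma (v + 2 / \<alpha>)" "0 \<le> Gamma v"
      using \<alpha> v by (auto intro!: less_imp_le[OF Gamma_real_pos] add_pos_pos)
    then show ?thesis by (subst ennreal_mult[symmetric]) (auto simp: kap_def mult_ac)
  qed
  also have "ennreal \<mu> * \<dots> = ennreal (\<mu> * kap * s powr (2 / \<alpha>))"
    using mu_pos kap_pos by (simp add: ennreal_mult mult_ac)
  finally show ?thesis using mu_pos kap_pos by (simp add: exp_neg_ennreal)
qed

text \<open>As s tends to 0, \<open>exp_neg (s * I)\<close> tends to the indicator of finite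
  \<open>I\<close>, while the Laplace transform tends to 1; so the sum is finite almost surely. As
  the marks are positive, the real series then converges to the same value.\<close>

lemma interference_AE:
  "AE \<omega> in Q. 0 \<le> interference \<omega> \<and>
     (\<Sum>l. ennreal (norm (X l \<omega>) powr (- \<alpha>) * Y l \<omega>)) = ennreal (interference \<omega>)"
proof -
  define I where "I \<omega> = (\<Sum>l. ennreal (norm (X l \<omega>) powr (- \<alpha>) * Y l \<omega>))" for \<omega>
  have [measurable]: "I \<in> borel_measurable Q" unfolding I_def[abs_def] by measurable
  have "(\<lambda>n. \<integral>\<^sup>+\<omega>. exp_neg (ennreal (1 / real (Suc n)) * I \<omega>) \<partial>Q)
     \<longlonglongrightarrow> (\<integral>\<^sup>+\<omega>. indicator {\<omega>\<in>space Q. I \<omega> < \<top>} \<omega> \<partial>Q)"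
  proof (rule nn_integral_dominated_convergence[where w="\<lambda>_. 1"])
    have "(\<lambda>n. exp_neg (ennreal (1 / real (Suc n)) * I \<omega>)) \<longlonglongrightarrow> indicator {\<omega>\<in>space Q. I \<omega> < \<top>} \<omega>" if "\<omega> \<in> space Q" for \<omega>
    proof (cases "I \<omega>")
      case (real r)
      have "(\<lambda>n. ennreal (1 / real (Suc n) * r)) \<longlonglongrightarrow> ennreal (0 * r)"
        by (intro tendsto_ennrealI tendsto_mult tendsto_const LIMSEQ_Suc[OF lim_1_over_n])
      from exp_neg_tendsto[OF this] show ?thesis using real that
        by (simp add: ennreal_mult[symmetric])
    next
      case top
      then show ?thesis by (simp add: ennreal_mult_top)
    qed
    then show "AE \<omega> in Q. (\<lambda>n. exp_neg (ennreal (1 / real (Suc n)) * I \<omega>)) \<longlonglongrightarrow> indicator {\<omega>\<in>space Q. I \<omega> < \<top>} \<omega>"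
      by simp
  qed (auto simp: exp_neg_le_1 emeasure_space_1)
  moreover have "(\<lambda>n. \<integral>\<^sup>+\<omega>. exp_neg (ennreal (1 / real (Suc n)) * I \<omega>) \<partial>Q) \<longlonglongrightarrow> ennreal (exp (- (\<mu> * kap * 0)))"
  proof -
    have "(\<lambda>n. (1 / real (Suc n)) powr (2 / \<alpha>)) \<longlonglongrightarrow> 0"
      using \<alpha> by (intro tendsto_zero_powrI[OF LIMSEQ_Suc[OF lim_1_over_n] tendsto_const]) auto
    then have "(\<lambda>n. ennreal (exp (- (\<mu> * kap * (1 / real (Suc n)) powr (2 / \<alpha>))))) \<longlonglongrightarrow> ennreal (exp (- (\<mu> * kap * 0)))"
      by (intro tendsto_ennrealI tendsto_exp tendsto_minus tendsto_mult tendsto_const)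
    then show ?thesis
      unfolding I_def by (subst ennreal_interference_laplace) auto
  qed
  ultimately have "(\<integral>\<^sup>+\<omega>. indicator {\<omega>\<in>space Q. I \<omega> < \<top>} \<omega> \<partial>Q) = 1"
    using LIMSEQ_unique by fastforce
  then have "AE \<omega> in Q. I \<omega> < \<top>"
    by (subst AE_iff_emeasure_eq_1) auto
  moreover have "AE \<omega> in Q. \<forall>l. 0 < Y l \<omega>"
    unfolding AE_all_countable
  proof
    fix l
    have "AE y in distr Q borel (Y l). 0 < y"
      unfolding distr_marks_S by (subst AE_density) (auto simp: gamma_density_def)
    then show "AE \<omega> in Q. 0 < Y l \<omega>" by (subst (asm) AE_distr_iff) auto
  qed
  ultimately show ?thesis
  proof eventually_elim
    case (elim \<omega>)
    define b where "b l = norm (X l \<omega>) powr (- \<alpha>) * Y l \<omega>" for l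
    have b: "0 \<le> b l" for l using elim(2)[rule_format, of l] by (simp add: b_def)
    have "(\<Sum>l. ennreal (b l)) \<noteq> \<top>" using elim(1) by (auto simp: I_def b_def)
    then have "summable b" using b by (intro summable_suminf_not_top) auto
    then show ?case using b unfolding interference_def b_def[symmetric]
      by (auto intro!: suminf_ennreal2 suminf_nonneg)
  qed
qed

lemma interference_measurable [measurable]: "interference \<in> borel_measurable Q"
  unfolding interference_def[abs_def] by measurable

lemma interference_laplace:
  assumes s: "0 < s"
  shows "expectation (\<lambda>\<omega>. exp (- (s * interference \<omega>))) = exp (- (\<mu> * kap * s powr (2 / \<alpha>)))"
proof -
  have "(\<integral>\<^sup>+\<omega>. ennreal (exp (- (s * interference \<omega>))) \<partial>Q) = ennreal (exp (- (\<mu> * kap * s powr (2 / \<alpha>))))"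
    unfolding ennreal_interference_laplace[OF s, symmetric]
  proof (rule nn_integral_cong_AE)
    show "AE \<omega> in Q. ennreal (exp (- (s * interference \<omega>))) =
       exp_neg (ennreal s * (\<Sum>l. ennreal (norm (X l \<omega>) powr (- \<alpha>) * Y l \<omega>)))"
      using interference_AE
      by eventually_elim (use s in \<open>simp add: exp_neg_ennreal ennreal_mult[symmetric]\<close>)
  qed
  then show ?thesis by (subst integral_eq_nn_integral) auto
qed

text \<open>The denominator is positive, so outage means W \<le> \<beta> (I + 1); the independent
  signal is integrated out given the interference.\<close>

lemma outage_prob_eq:
  assumes W: "gamma_distributed Q W (real n) \<theta>'" and n: "0 < n" and \<theta>': "0 < \<theta>'" and \<beta>: "0 < \<beta>"
  shows "outage_prob \<alpha> S \<beta> \<mu> = expectation (\<lambda>\<omega>. erlang_CDF (n - 1) 1 (\<beta> / \<theta>' * (interference \<omega> + 1)))"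
proof -
  have D: "distributed Q lborel W (erlang_density (n - 1) (1 / \<theta>'))"
    using W n \<theta>' by (simp add: gamma_distributed_iff_erlang)
  have cdf: "prob {\<omega>\<in>space Q. W \<omega> \<le> a} = erlang_CDF (n - 1) 1 (a / \<theta>')" if "0 \<le> a" for a
    using erlang_distributed_le[OF D _ that] \<theta>' by (simp add: erlang_CDF_transform[of "1 / \<theta>'"])
  have V: "interference \<in> borel_measurable (other_sources Signal)"
  proof -
    have [measurable]: "X l \<in> borel_measurable (other_sources Signal)" "Y l \<in> borel_measurable (other_sources Signal)" for l
      using nodes_other_sources[of Signal] marks_other_sources[of Signal] by auto
    show ?thesis unfolding interference_def[abs_def] by measurable
  qed
  have "emeasure Q {\<omega>\<in>space Q. sinr \<alpha> S \<mu> \<omega> \<le> \<beta>} = (\<integral>\<^sup>+\<omega>. indicator {\<omega>\<in>space Q. sinr \<alpha> S \<mu> \<omega> \<le> \<beta>} \<omega> \<partial>Q)"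
    by (subst nn_integral_indicator) (auto simp: sinr_def)
  also have "\<dots> = (\<integral>\<^sup>+\<omega>. (if W \<omega> \<le> \<beta> * (interference \<omega> + 1) then 1 else 0) \<partial>Q)"
  proof (rule nn_integral_cong_AE)
    show "AE \<omega> in Q. (indicator {\<omega>\<in>space Q. sinr \<alpha> S \<mu> \<omega> \<le> \<beta>} \<omega> :: ennreal) =
        (if W \<omega> \<le> \<beta> * (interference \<omega> + 1) then 1 else 0)"
      using interference_AE AE_space
    proof eventually_elim
      case (elim \<omega>)
      have "sinr \<alpha> S \<mu> \<omega> = W \<omega> / (interference \<omega> + 1)" by (simp add: sinr_def interference_def)
      then show ?case using elim by (simp add: indicator_def pos_divide_le_eq)
    qed
  qed
  also have "\<dots> = (\<integral>\<^sup>+\<omega>. (\<integral>\<^sup>+\<omega>'. (if W \<omega>' \<le> \<beta> * (interference \<omega> + 1) then 1 else 0) \<partial>Q) \<partial>Q)"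
    using nn_integral_source[OF V signal_S, of "\<lambda>p. if snd p \<le> \<beta> * (fst p + 1) then 1 else 0"]
    by (simp add: in_vimage_algebra)
  also have "\<dots> = (\<integral>\<^sup>+\<omega>. ennreal (erlang_CDF (n - 1) 1 (\<beta> / \<theta>' * (interference \<omega> + 1))) \<partial>Q)"
  proof (rule nn_integral_cong_AE)
    show "AE \<omega> in Q. (\<integral>\<^sup>+\<omega>'. (if W \<omega>' \<le> \<beta> * (interference \<omega> + 1) then 1 else 0) \<partial>Q)
       = ennreal (erlang_CDF (n - 1) 1 (\<beta> / \<theta>' * (interference \<omega> + 1)))"
      using interference_AE
    proof eventually_elim
      case (elim \<omega>)
      have "(\<integral>\<^sup>+\<omega>'. (if W \<omega>' \<le> \<beta> * (interference \<omega> + 1) then 1 else 0) \<partial>Q)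
          = (\<integral>\<^sup>+\<omega>'. indicator {\<omega>'\<in>space Q. W \<omega>' \<le> \<beta> * (interference \<omega> + 1)} \<omega>' \<partial>Q)"
        by (intro nn_integral_cong) (auto simp: indicator_def)
      also have "\<dots> = ennreal (prob {\<omega>'\<in>space Q. W \<omega>' \<le> \<beta> * (interference \<omega> + 1)})"
        by (subst nn_integral_indicator) (auto simp: emeasure_eq_measure)
      finally show ?case using elim \<beta> by (simp add: cdf)
    qed
  qed
  finally have "emeasure Q {\<omega>\<in>space Q. sinr \<alpha> S \<mu> \<omega> \<le> \<beta>}
      = (\<integral>\<^sup>+\<omega>. ennreal (erlang_CDF (n - 1) 1 (\<beta> / \<theta>' * (interference \<omega> + 1))) \<partial>Q)" .
  then show ?thesis
    unfolding outage_prob_def measure_def by (subst integral_eq_nn_integral) auto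
qed

end

section \<open>The outage probability as a function of the interference scale\<close>

text \<open>With \<open>max 0 x\<close> one formula covers both signs, which makes continuity on all
  reals immediate.\<close>

lemma erlang_CDF_conv_max:
  "erlang_CDF k 1 x = 1 - (\<Sum>n\<le>k. (max 0 x) ^ n * exp (- max 0 x) / fact n)"
proof (cases "x < 0")
  case True
  have "(\<Sum>n\<le>k. (0::real) ^ n * exp (- 0) / fact n) = (\<Sum>n\<le>k. if n = 0 then 1 else 0)"
    by (intro sum.cong) auto
  then show ?thesis using True by (simp add: erlang_CDF_def)
qed (simp add: erlang_CDF_def)

lemma continuous_on_erlang_CDF: "continuous_on A (erlang_CDF k 1)"
  unfolding erlang_CDF_conv_max[abs_def]
  by (intro continuous_on_diff continuous_on_sum continuous_on_divide continuous_on_mult continuous_on_power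
    continuous_on_exp continuous_on_minus continuous_on_max continuous_on_const continuous_on_id) simp

lemma tendsto_erlang_CDF: "(f \<longlongrightarrow> a) F \<Longrightarrow> ((\<lambda>x. erlang_CDF k 1 (f x)) \<longlongrightarrow> erlang_CDF k 1 a) F"
  using continuous_on_erlang_CDF[of UNIV k] unfolding continuous_on_eq_continuous_at[OF open_UNIV]
  by (blast intro: isCont_tendsto_compose[of a "erlang_CDF k 1" f F])

lemma erlang_CDF_at_top: "(erlang_CDF k 1 \<longlongrightarrow> 1) at_top"
proof -
  have "((\<lambda>x::real. 1 - (\<Sum>n\<le>k. (x ^ n / exp x) * (1 / fact n))) \<longlongrightarrow> 1 - (\<Sum>n\<le>k. 0 * (1 / fact n))) at_top"
    by (intro tendsto_intros tendsto_power_div_exp_0)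
  moreover have "eventually (\<lambda>x. 1 - (\<Sum>n\<le>k. (x ^ n / exp x) * (1 / fact n)) = erlang_CDF k 1 x) at_top"
    using eventually_ge_at_top[of 0] by eventually_elim (auto simp: erlang_CDF_def exp_minus field_simps)
  ultimately have "(erlang_CDF k 1 \<longlongrightarrow> 1 - (\<Sum>n\<le>k. 0 * (1 / fact n))) at_top"
    by (rule Lim_transform_eventually)
  then show ?thesis by simp
qed

lemma erlang_CDF_le_1: "erlang_CDF k 1 x \<le> 1"
  unfolding erlang_CDF_conv_max by (auto intro!: sum_nonneg)

lemma erlang_CDF_strict_mono:
  assumes "0 \<le> x" "x < y"
  shows "erlang_CDF k 1 x < erlang_CDF k 1 y"
proof (rule DERIV_pos_imp_increasing_open[OF assms(2)])
  fix z assume z: "x < z" "z < y"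
  \<comment> \<open>The derivative telescopes to the Erlang density, which is positive for positive
    arguments.\<close>
  have D: "((\<lambda>x. 1 - (\<Sum>n\<le>k. x ^ n * exp (- x) / fact n)) has_real_derivative (u ^ k * exp (- u) / fact k)) (at u)" for u :: real
  proof (induction k)
    case 0
    show ?case by (auto intro!: derivative_eq_intros)
  next
    case (Suc k)
    have pow: "((\<lambda>x. x ^ Suc k) has_real_derivative (real (Suc k) * u ^ k)) (at u)"
      using DERIV_pow[of "Suc k" u] by simp
    have exp: "((\<lambda>x. exp (- x)) has_real_derivative - exp (- u)) (at u)"
      by (auto intro!: derivative_eq_intros)
    have "((\<lambda>x. (1 - (\<Sum>n\<le>k. x ^ n * exp (- x) / fact n)) - x ^ Suc k * exp (- x) / fact (Suc k))
       has_real_derivative (u ^ k * exp (- u) / fact k -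
         (real (Suc k) * u ^ k * exp (- u) + (- exp (- u)) * u ^ Suc k) / fact (Suc k))) (at u)"
      by (intro DERIV_diff Suc DERIV_cdivide DERIV_mult pow exp)
    moreover have "real (Suc k) * u ^ k * exp (- u) / fact (Suc k) = u ^ k * exp (- u) / fact k"
      by (simp add: mult.assoc del: of_nat_Suc)
    then have "u ^ k * exp (- u) / fact k -
         (real (Suc k) * u ^ k * exp (- u) + (- exp (- u)) * u ^ Suc k) / fact (Suc k) = u ^ Suc k * exp (- u) / fact (Suc k)"
      by (simp only: add_divide_distrib) simp
    ultimately show ?case by (simp only: sum.atMost_Suc diff_diff_eq)
  qed
  have "(erlang_CDF k 1 has_real_derivative (z ^ k * exp (- z) / fact k)) (at z)"
  proof (rule has_field_derivative_transform_within_open[OF D])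
    show "z \<in> {0<..}" using z assms by simp
    show "1 - (\<Sum>n\<le>k. u ^ n * exp (- u) / fact n) = erlang_CDF k 1 u" if "u \<in> {0<..}" for u
      using that by (simp add: erlang_CDF_def)
  qed auto
  then show "\<exists>d. (erlang_CDF k 1 has_real_derivative d) (at z) \<and> 0 < d"
    using z assms by (auto intro!: exI[of _ "z ^ k * exp (- z) / fact k"])
qed (rule continuous_on_erlang_CDF)

lemma erlang_CDF_mono:
  assumes "x \<le> y" shows "erlang_CDF k 1 x \<le> erlang_CDF k 1 y"
proof (cases "0 \<le> x")
  case True
  then show ?thesis using assms erlang_CDF_strict_mono[of x y k] by (cases "x = y") auto
next
  case False
  then show ?thesis by (simp add: erlang_CDF_def[of k 1 x] erlang_CDF_nonneg)
qed

text \<open>Chebyshev's inequality with mean and variance \<open>n\<close>: half of the mean is a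
  deviation of \<open>n / 2\<close>, twice the mean one of \<open>n\<close>.\<close>

lemma erlang_CDF_concentration:
  assumes n: "0 < n"
  shows "erlang_CDF (n - 1) 1 (real n / 2) \<le> 4 / real n"
    and "1 - 1 / real n \<le> erlang_CDF (n - 1) 1 (2 * real n)"
proof -
  let ?D = "density lborel (\<lambda>x. ennreal (erlang_density (n - 1) 1 x))"
  interpret D: prob_space ?D by (rule prob_space_erlang_density) simp
  have dist: "distributed ?D lborel (\<lambda>x. x) (\<lambda>x. ennreal (erlang_density (n - 1) 1 x))"
    by (auto simp: distributed_def distr_id2 cong: distr_cong)
  have E: "D.expectation (\<lambda>x. x) = real n"
    using D.erlang_ith_moment[OF _ dist, of 1] n by (simp add: fact_reduce)
  have V: "D.variance (\<lambda>x. x) = real n"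
    using D.erlang_distributed_variance[OF _ dist] n by simp
  have int: "integrable ?D (\<lambda>x. x ^ 2)" using D.erlang_ith_moment_integrable[OF _ dist, of 2] by simp
  have cheb: "D.prob {x\<in>space ?D. a \<le> \<bar>x - real n\<bar>} \<le> real n / a\<^sup>2" if "0 < a" for a
    using D.Chebyshev_inequality[of "\<lambda>x. x" a] int that unfolding V unfolding E by simp
  have cdf: "D.prob {x\<in>space ?D. x \<le> a} = erlang_CDF (n - 1) 1 a" if "0 \<le> a" for a
    using D.erlang_distributed_le[OF dist _ that] by simp
  have "erlang_CDF (n - 1) 1 (real n / 2) = D.prob {x\<in>space ?D. x \<le> real n / 2}"
    by (rule cdf[symmetric]) simp
  also have "\<dots> \<le> D.prob {x\<in>space ?D. real n / 2 \<le> \<bar>x - real n\<bar>}"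
    by (intro D.finite_measure_mono) auto
  also have "\<dots> \<le> 4 / real n"
    using cheb[of "real n / 2"] n by (simp add: power2_eq_square field_simps)
  finally show "erlang_CDF (n - 1) 1 (real n / 2) \<le> 4 / real n" .
  have "1 = D.prob (space ?D)" by (rule D.prob_space[symmetric])
  also have "\<dots> \<le> D.prob ({x\<in>space ?D. x \<le> 2 * real n} \<union> {x\<in>space ?D. real n \<le> \<bar>x - real n\<bar>})"
    by (intro D.finite_measure_mono) auto
  also have "\<dots> \<le> D.prob {x\<in>space ?D. x \<le> 2 * real n} + D.prob {x\<in>space ?D. real n \<le> \<bar>x - real n\<bar>}"
    by (intro measure_Un_le) auto
  also have "\<dots> \<le> erlang_CDF (n - 1) 1 (2 * real n) + 1 / real n"
    using cheb[of "real n"] cdf[of "2 * real n"] n by (simp add: power2_eq_square)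
  finally show "1 - 1 / real n \<le> erlang_CDF (n - 1) 1 (2 * real n)" by simp
qed

text \<open>
  Laplace transforms at the positive integers are the moments of \<open>exp (- U)\<close>, which determine
  its law by the Weierstrass theorem.
\<close>

lemma laplace_transform_unique:
  fixes \<psi> :: "real \<Rightarrow> real"
  assumes P: "prob_space P" and Q: "prob_space Q"
    and U [measurable]: "U \<in> borel_measurable P" and V [measurable]: "V \<in> borel_measurable Q"
    and Upos: "AE \<omega> in P. 0 \<le> U \<omega>" and Vpos: "AE \<omega> in Q. 0 \<le> V \<omega>"
    and eq: "\<And>k::nat. 0 < k \<Longrightarrow> (\<integral>\<omega>. exp (- (real k * U \<omega>)) \<partial>P) = (\<integral>\<omega>. exp (- (real k * V \<omega>)) \<partial>Q)"
    and \<psi>: "continuous_on {0..1} \<psi>" and \<psi>m [measurable]: "\<psi> \<in> borel_measurable borel"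
  shows "(\<integral>\<omega>. \<psi> (exp (- U \<omega>)) \<partial>P) = (\<integral>\<omega>. \<psi> (exp (- V \<omega>)) \<partial>Q)"
proof -
  obtain B where B: "\<And>x. x \<in> {0..1} \<Longrightarrow> \<bar>\<psi> x\<bar> \<le> B"
    using compact_imp_bounded[OF compact_continuous_image[OF \<psi> compact_Icc]]
    unfolding bounded_iff ball_simps real_norm_def by blast
  have approx: "\<bar>(\<integral>\<omega>. \<psi> (exp (- Z \<omega>)) \<partial>M) - (\<Sum>i\<le>n. a i * (\<integral>\<omega>. exp (- (real i * Z \<omega>)) \<partial>M))\<bar> \<le> e"
    if M: "prob_space M" and [measurable]: "Z \<in> borel_measurable M" and Zpos: "AE \<omega> in M. 0 \<le> Z \<omega>"
      and p: "\<And>x. x \<in> {0..1} \<Longrightarrow> \<bar>\<psi> x - (\<Sum>i\<le>n. a i * x ^ i)\<bar> < e" for M :: "'c measure" and Z a n e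
  proof -
    interpret prob_space M by fact
    have i1: "integrable M (\<lambda>\<omega>. \<psi> (exp (- Z \<omega>)))"
      using Zpos by (intro integrable_const_bound[of _ B]) (auto intro!: B)
    have i2: "integrable M (\<lambda>\<omega>. exp (- (real i * Z \<omega>)))" for i
      using Zpos by (intro integrable_const_bound[of _ 1]) auto
    have "(\<integral>\<omega>. \<psi> (exp (- Z \<omega>)) \<partial>M) - (\<Sum>i\<le>n. a i * (\<integral>\<omega>. exp (- (real i * Z \<omega>)) \<partial>M))
        = (\<integral>\<omega>. \<psi> (exp (- Z \<omega>)) - (\<Sum>i\<le>n. a i * exp (- (real i * Z \<omega>))) \<partial>M)"
      using i1 i2 by (simp add: Bochner_Integration.integral_diff)
    also have "\<bar>\<dots>\<bar> \<le> (\<integral>\<omega>. \<bar>\<psi> (exp (- Z \<omega>)) - (\<Sum>i\<le>n. a i * exp (- (real i * Z \<omega>)))\<bar> \<partial>M)"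
      by (rule integral_abs_bound)
    also have "\<dots> \<le> (\<integral>\<omega>. e \<partial>M)"
    proof (rule integral_mono_AE)
      show "AE \<omega> in M. \<bar>\<psi> (exp (- Z \<omega>)) - (\<Sum>i\<le>n. a i * exp (- (real i * Z \<omega>)))\<bar> \<le> e"
        using Zpos
      proof eventually_elim
        case (elim \<omega>)
        have "exp (- (real i * Z \<omega>)) = exp (- Z \<omega>) ^ i" for i
          by (simp add: exp_of_nat_mult[symmetric])
        then show ?case using p[of "exp (- Z \<omega>)"] elim by simp
      qed
    qed (use i1 i2 in auto)
    finally show ?thesis by (simp add: prob_space)
  qed
  show ?thesis
  proof (rule ccontr)
    assume neq: "\<not> ?thesis"
    \<comment> \<open>A third of the gap: both expectations are within \<open>e\<close> of the same
      polynomial value, so the gap would be at most \<open>2 * e\<close>.\<close>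
    define e where "e = \<bar>(\<integral>\<omega>. \<psi> (exp (- U \<omega>)) \<partial>P) - (\<integral>\<omega>. \<psi> (exp (- V \<omega>)) \<partial>Q)\<bar> / 3"
    have e: "0 < e" using neq by (simp add: e_def)
    obtain p where p: "real_polynomial_function p" "\<And>x. x \<in> {0..1} \<Longrightarrow> \<bar>\<psi> x - p x\<bar> < e"
      using Stone_Weierstrass_real_polynomial_function[OF compact_Icc \<psi> e] by blast
    obtain a n where pa: "p = (\<lambda>x. \<Sum>i\<le>n. a i * x ^ i)"
      using p(1) unfolding real_polynomial_function_iff_sum by blast
    interpret P: prob_space P by fact
    interpret Q: prob_space Q by fact
    have same: "(\<integral>\<omega>. exp (- (real i * U \<omega>)) \<partial>P) = (\<integral>\<omega>. exp (- (real i * V \<omega>)) \<partial>Q)" for i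
      using eq[of i] by (cases "i = 0") (auto simp: P.prob_space Q.prob_space)
    show False
      using approx[OF P U Upos, of a n e] approx[OF Q V Vpos, of a n e] p(2) e
      unfolding pa same e_def by (simp add: abs_if split: if_splits)
  qed
qed

text \<open>One-sided stable law of index \<open>d\<close>, given by its Laplace transform.
  Existence comes from the models themselves: their normalised interference is an instance, see
  \<open>stable_variable_interference\<close>.\<close>

locale stable_variable = prob_space Q for Q :: "'w measure" +
  fixes Z :: "'w \<Rightarrow> real" and d :: real
  assumes Z_measurable [measurable]: "Z \<in> borel_measurable Q"
    and Z_nonneg: "AE \<omega> in Q. 0 \<le> Z \<omega>"
    and Z_laplace: "\<And>s. 0 < s \<Longrightarrow> expectation (\<lambda>\<omega>. exp (- (s * Z \<omega>))) = exp (- (s powr d))"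
    and d_pos: "0 < d"
begin

text \<open>As s tends to \<infinity>, \<open>exp (- (s * Z))\<close> tends to the indicator of
  \<open>Z = 0\<close>, while the Laplace transform tends to 0.\<close>

lemma Z_pos: "AE \<omega> in Q. 0 < Z \<omega>"
proof -
  have "(\<lambda>n. expectation (\<lambda>\<omega>. exp (- (real (Suc n) * Z \<omega>)))) \<longlonglongrightarrow> expectation (indicator {\<omega>\<in>space Q. Z \<omega> = 0} :: _ \<Rightarrow> real)"
  proof (rule integral_dominated_convergence[where w="\<lambda>_. 1"])
    show "AE \<omega> in Q. (\<lambda>n. exp (- (real (Suc n) * Z \<omega>))) \<longlonglongrightarrow> indicator {\<omega>\<in>space Q. Z \<omega> = 0} \<omega>"
      using Z_nonneg AE_space
    proof eventually_elim
      case (elim \<omega>)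
      show ?case
      proof (cases "Z \<omega> = 0")
        case False
        then have Z: "0 < Z \<omega>" using elim by simp
        have "filterlim (\<lambda>n. real (Suc n) * Z \<omega>) at_top sequentially"
          using Z by (intro filterlim_at_top_mult_tendsto_pos[OF tendsto_const _ filterlim_compose[OF filterlim_real_sequentially filterlim_Suc]])
        then have "(\<lambda>n. exp (- (real (Suc n) * Z \<omega>))) \<longlonglongrightarrow> 0"
          by (intro filterlim_compose[OF exp_at_bot] filterlim_compose[OF filterlim_uminus_at_bot_at_top])
        then show ?thesis using False by simp
      qed (use elim in simp)
    qed
    show "AE \<omega> in Q. norm (exp (- (real (Suc n) * Z \<omega>))) \<le> 1" for n
      using Z_nonneg by eventually_elim (auto intro: mult_nonneg_nonneg)
  qed auto
  moreover have "(\<lambda>n. expectation (\<lambda>\<omega>. exp (- (real (Suc n) * Z \<omega>)))) \<longlonglongrightarrow> 0"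
  proof -
    have "filterlim (\<lambda>n. exp (d * ln (real (Suc n)))) at_top sequentially"
      by (intro filterlim_compose[OF exp_at_top] filterlim_tendsto_pos_mult_at_top[OF tendsto_const d_pos]
        filterlim_compose[OF ln_at_top] filterlim_compose[OF filterlim_real_sequentially filterlim_Suc])
    then have "filterlim (\<lambda>n. real (Suc n) powr d) at_top sequentially" by (simp add: powr_def)
    then have "(\<lambda>n. exp (- (real (Suc n) powr d))) \<longlonglongrightarrow> 0"
      by (intro filterlim_compose[OF exp_at_bot] filterlim_compose[OF filterlim_uminus_at_bot_at_top])
    then show ?thesis by (subst Z_laplace) auto
  qed
  ultimately have "expectation (indicator {\<omega>\<in>space Q. Z \<omega> = 0} :: _ \<Rightarrow> real) = 0"
    using LIMSEQ_unique by blast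
  then have "prob {\<omega>\<in>space Q. Z \<omega> = 0} = 0" by simp
  then have "AE \<omega> in Q. Z \<omega> \<noteq> 0" by (subst (asm) prob_eq_0) auto
  then show ?thesis using Z_nonneg by eventually_elim auto
qed

text \<open>For \<open>n > 0\<close>, the probability that an independent Erlang variable of shape
  \<open>n\<close> and scale 1 is at most \<open>b + t * Z\<close>, with the Erlang variable already
  integrated out.\<close>

definition outage_law :: "nat \<Rightarrow> real \<Rightarrow> real \<Rightarrow> real" where
  "outage_law n b t = expectation (\<lambda>\<omega>. erlang_CDF (n - 1) 1 (b + t * Z \<omega>))"

lemma integrable_erlang_CDF [simp]:
  assumes [measurable]: "f \<in> borel_measurable Q"
  shows "integrable Q (\<lambda>\<omega>. erlang_CDF k 1 (f \<omega>))"
  by (rule integrable_const_bound[of _ 1]) (auto simp: erlang_CDF_le_1)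

lemma outage_law_0: "outage_law n b 0 = erlang_CDF (n - 1) 1 b"
  by (simp add: outage_law_def prob_space)

lemma outage_law_strict_mono:
  assumes "0 \<le> b" "0 \<le> t" "t < u"
  shows "outage_law n b t < outage_law n b u"
  unfolding outage_law_def
proof (rule integral_less_AE_space)
  show "AE \<omega> in Q. erlang_CDF (n - 1) 1 (b + t * Z \<omega>) < erlang_CDF (n - 1) 1 (b + u * Z \<omega>)"
    using Z_pos by eventually_elim (use assms in \<open>auto intro!: erlang_CDF_strict_mono\<close>)
qed (auto simp: emeasure_space_1)

lemma continuous_on_outage_law: "continuous_on (A :: real set) (outage_law n b)"
  unfolding continuous_on_sequentially
proof safe
  fix x :: "nat \<Rightarrow> real" and a assume "x \<longlonglongrightarrow> a"
  show "(outage_law n b \<circ> x) \<longlonglongrightarrow> outage_law n b a"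
    unfolding outage_law_def comp_def
    using \<open>x \<longlonglongrightarrow> a\<close>
    by (intro integral_dominated_convergence[where w="\<lambda>_. 1"])
      (auto intro!: tendsto_erlang_CDF tendsto_intros simp: erlang_CDF_le_1)
qed

lemma outage_law_tendsto_1: "(\<lambda>j. outage_law n b (real j)) \<longlonglongrightarrow> 1"
proof -
  have "(\<lambda>j. outage_law n b (real j)) \<longlonglongrightarrow> expectation (\<lambda>_. 1)"
    unfolding outage_law_def
  proof (rule integral_dominated_convergence[where w="\<lambda>_. 1"])
    show "AE \<omega> in Q. (\<lambda>j. erlang_CDF (n - 1) 1 (b + real j * Z \<omega>)) \<longlonglongrightarrow> 1"
      using Z_pos
    proof eventually_elim
      case (elim \<omega>)
      then have "filterlim (\<lambda>j. b + real j * Z \<omega>) at_top sequentially"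
        by (intro filterlim_tendsto_add_at_top[OF tendsto_const]
          filterlim_at_top_mult_tendsto_pos[OF tendsto_const _ filterlim_real_sequentially])
      then show ?case by (rule filterlim_compose[OF erlang_CDF_at_top])
    qed
  qed (auto simp: erlang_CDF_le_1)
  then show ?thesis by (simp add: prob_space)
qed

text \<open>Intermediate value theorem between \<open>t = 0\<close>, where the value is the outage
  without interference, and large \<open>t\<close>, where it tends to 1.\<close>

lemma outage_law_attains:
  assumes "erlang_CDF (n - 1) 1 b < \<epsilon>" "\<epsilon> < 1"
  obtains t where "0 < t" "outage_law n b t = \<epsilon>"
proof -
  have "eventually (\<lambda>j. \<epsilon> < outage_law n b (real j)) sequentially"
    using order_tendstoD(1)[OF outage_law_tendsto_1 assms(2)] .
  then obtain j where j: "\<epsilon> < outage_law n b (real j)" by (auto simp: eventually_sequentially)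
  obtain t where t: "0 \<le> t" "outage_law n b t = \<epsilon>"
    using IVT'[of "outage_law n b" 0 \<epsilon> "real j"] assms j continuous_on_outage_law
    by (auto simp: outage_law_0)
  then have "t \<noteq> 0" using assms by (auto simp: outage_law_0)
  then show ?thesis using t by (intro that) auto
qed

text \<open>If t is small against n, then b + t Z stays below n/2 unless Z is large; if t is large
  against n, then t Z exceeds 2n unless Z is close to 0. By concentration of the Erlang variable the
  outage probability would be below \<epsilon>, respectively above it. The constants depend only on
  \<open>Z\<close> and \<epsilon>, so the bounds are uniform in \<open>n\<close> and
  \<open>b\<close>.\<close>

lemma outage_law_solution_bounds:
  assumes \<epsilon>: "0 < \<epsilon>" "\<epsilon> < 1"
  obtains c1 c2 n0 where "0 < c1" "0 < c2"
    "\<And>n b t. n0 \<le> real n \<Longrightarrow> 0 < n \<Longrightarrow> 0 \<le> b \<Longrightarrow> b \<le> real n / 4 \<Longrightarrow> 0 \<le> t \<Longrightarrow> outage_law n b t = \<epsilon> \<Longrightarrow>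
       c1 * real n \<le> t \<and> t \<le> c2 * real n"
proof -
  have "(\<lambda>j. expectation (indicator {\<omega>\<in>space Q. real j < Z \<omega>})) \<longlonglongrightarrow> expectation (\<lambda>_. 0 :: real)"
  proof (rule integral_dominated_convergence[where w="\<lambda>_. 1"])
    have "(\<lambda>j. indicator {\<omega>\<in>space Q. real j < Z \<omega>} \<omega>) \<longlonglongrightarrow> (0::real)" for \<omega>
    proof -
      obtain k where "Z \<omega> < real k" using reals_Archimedean2 by blast
      then have "eventually (\<lambda>j. 0 = (indicator {\<omega>\<in>space Q. real j < Z \<omega>} \<omega> :: real)) sequentially"
        unfolding eventually_sequentially by (intro exI[of _ k]) (auto simp: indicator_def)
      then show ?thesis using tendsto_const by (rule Lim_transform_eventually[rotated])
    qed
    then show "AE \<omega> in Q. (\<lambda>j. indicator {\<omega>\<in>space Q. real j < Z \<omega>} \<omega>) \<longlonglongrightarrow> (0::real)" by simp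
  qed auto
  then have "(\<lambda>j. prob {\<omega>\<in>space Q. real j < Z \<omega>}) \<longlonglongrightarrow> 0" by simp
  then have "eventually (\<lambda>j. prob {\<omega>\<in>space Q. real j < Z \<omega>} < \<epsilon> / 2) sequentially"
    using \<epsilon> by (intro order_tendstoD) auto
  then obtain j where j: "prob {\<omega>\<in>space Q. real j < Z \<omega>} < \<epsilon> / 2" by (auto simp: eventually_sequentially)
  have "(\<lambda>j. expectation (indicator {\<omega>\<in>space Q. 1 / real (Suc j) \<le> Z \<omega>})) \<longlonglongrightarrow> expectation (\<lambda>_. 1 :: real)"
  proof (rule integral_dominated_convergence[where w="\<lambda>_. 1"])
    show "AE \<omega> in Q. (\<lambda>j. indicator {\<omega>\<in>space Q. 1 / real (Suc j) \<le> Z \<omega>} \<omega>) \<longlonglongrightarrow> (1::real)"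
      using Z_pos AE_space
    proof eventually_elim
      case (elim \<omega>)
      have "eventually (\<lambda>j. 1 / real (Suc j) < Z \<omega>) sequentially"
        using elim by (intro order_tendstoD(2)[OF LIMSEQ_Suc[OF lim_1_over_n]]) auto
      then have "eventually (\<lambda>j. 1 = (indicator {\<omega>\<in>space Q. 1 / real (Suc j) \<le> Z \<omega>} \<omega> :: real)) sequentially"
        by eventually_elim (use elim in auto)
      then show ?case using tendsto_const by (rule Lim_transform_eventually[rotated])
    qed
  qed auto
  then have "(\<lambda>j. prob {\<omega>\<in>space Q. 1 / real (Suc j) \<le> Z \<omega>}) \<longlonglongrightarrow> 1" by (simp add: prob_space)
  then have "eventually (\<lambda>j. (1 + \<epsilon>) / 2 < prob {\<omega>\<in>space Q. 1 / real (Suc j) \<le> Z \<omega>}) sequentially"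
    using \<epsilon> by (intro order_tendstoD) auto
  then obtain i where i: "(1 + \<epsilon>) / 2 < prob {\<omega>\<in>space Q. 1 / real (Suc i) \<le> Z \<omega>}"
    by (auto simp: eventually_sequentially)
  \<comment> \<open>Tail cut-offs for \<open>Z\<close>: mass less than \<epsilon>/2 lies above
    \<open>y1\<close>, and mass more than (1 + \<epsilon>)/2 lies at or above
    \<open>y2\<close>.\<close>
  define y1 y2 where "y1 = real j + 1" and "y2 = 1 / real (Suc i)"
  have y: "0 < y1" "0 < y2" by (auto simp: y1_def y2_def)
  have p1: "prob {\<omega>\<in>space Q. y1 < Z \<omega>} < \<epsilon> / 2"
    using j by (rule le_less_trans[rotated]) (auto intro!: finite_measure_mono simp: y1_def)
  have p2: "(1 + \<epsilon>) / 2 < prob {\<omega>\<in>space Q. y2 \<le> Z \<omega>}" using i by (simp add: y2_def)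
  show thesis
  \<comment> \<open>With \<open>t < n / (4 * y1)\<close>,
    \<open>b + t * Z \<le> n / 4 + n / 4\<close> on \<open>Z \<le> y1\<close>; with
    \<open>t > 2 * n / y2\<close>, \<open>t * Z \<ge> 2 * n\<close> on \<open>Z \<ge> y2\<close>.
    The third witness is a sum so that \<open>4 / n \<le> \<epsilon> / 2\<close> and
    \<open>1 / n \<le> (1 - \<epsilon>) / 2\<close> hold together.\<close>
  proof (rule that[of "1 / (4 * y1)" "2 / y2" "8 / \<epsilon> + 2 / (1 - \<epsilon>)"])
    fix n :: nat and b t
    assume n0: "8 / \<epsilon> + 2 / (1 - \<epsilon>) \<le> real n" and n: "0 < n" and b: "0 \<le> b" "b \<le> real n / 4"
      and t: "0 \<le> t" and sol: "outage_law n b t = \<epsilon>"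
    have "0 \<le> 8 / \<epsilon>" "0 \<le> 2 / (1 - \<epsilon>)" using \<epsilon> by auto
    then have "8 / \<epsilon> \<le> real n" "2 / (1 - \<epsilon>) \<le> real n" using n0 by linarith+
    then have n1: "4 / real n \<le> \<epsilon> / 2" and n2: "1 / real n \<le> (1 - \<epsilon>) / 2"
      using n \<epsilon> by (simp_all add: field_simps)
    have "\<not> t < 1 / (4 * y1) * real n"
    proof
      assume "t < 1 / (4 * y1) * real n"
      then have ty: "t * y1 \<le> real n / 4" using y by (simp add: field_simps)
      have "outage_law n b t \<le> expectation (\<lambda>\<omega>. 4 / real n + indicator {\<omega>\<in>space Q. y1 < Z \<omega>} \<omega>)"
        unfolding outage_law_def
      proof (rule integral_mono_AE)
        show "AE \<omega> in Q. erlang_CDF (n - 1) 1 (b + t * Z \<omega>) \<le> 4 / real n + indicator {\<omega>\<in>space Q. y1 < Z \<omega>} \<omega>"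
          using AE_space
        proof eventually_elim
          case (elim \<omega>)
          show ?case
          proof (cases "y1 < Z \<omega>")
            case True
            then show ?thesis using elim erlang_CDF_le_1[of "n - 1" "b + t * Z \<omega>"] by (simp add: add_increasing)
          next
            case False
            then have "t * Z \<omega> \<le> t * y1" using t by (intro mult_left_mono) auto
            then have "erlang_CDF (n - 1) 1 (b + t * Z \<omega>) \<le> erlang_CDF (n - 1) 1 (real n / 2)"
              using b ty by (intro erlang_CDF_mono) linarith
            then show ?thesis using erlang_CDF_concentration(1)[OF n] False by simp
          qed
        qed
      qed (auto intro!: Bochner_Integration.integrable_add integrable_real_indicator simp: less_top[symmetric])
      also have "\<dots> = 4 / real n + prob {\<omega>\<in>space Q. y1 < Z \<omega>}"
        by (subst Bochner_Integration.integral_add)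
          (auto simp: prob_space less_top[symmetric] intro!: integrable_real_indicator)
      also have "\<dots> < \<epsilon>" using p1 n1 by linarith
      finally show False using sol by simp
    qed
    moreover have "\<not> 2 / y2 * real n < t"
    proof
      assume "2 / y2 * real n < t"
      then have ty: "2 * real n \<le> t * y2" using y by (simp add: field_simps)
      have "(1 - 1 / real n) * prob {\<omega>\<in>space Q. y2 \<le> Z \<omega>}
          = expectation (\<lambda>\<omega>. (1 - 1 / real n) * indicator {\<omega>\<in>space Q. y2 \<le> Z \<omega>} \<omega>)"
        by simp
      also have "\<dots> \<le> outage_law n b t"
        unfolding outage_law_def
      proof (rule integral_mono_AE)
        show "AE \<omega> in Q. (1 - 1 / real n) * indicator {\<omega>\<in>space Q. y2 \<le> Z \<omega>} \<omega> \<le> erlang_CDF (n - 1) 1 (b + t * Z \<omega>)"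
          using AE_space
        proof eventually_elim
          case (elim \<omega>)
          show ?case
          proof (cases "y2 \<le> Z \<omega>")
            case False
            then show ?thesis by simp
          next
            case True
            then have "t * y2 \<le> t * Z \<omega>" using t by (intro mult_left_mono) auto
            then have "erlang_CDF (n - 1) 1 (2 * real n) \<le> erlang_CDF (n - 1) 1 (b + t * Z \<omega>)"
              using b ty by (intro erlang_CDF_mono) linarith
            then show ?thesis using erlang_CDF_concentration(2)[OF n] True elim by simp
          qed
        qed
      qed (auto intro!: integrable_real_indicator simp: less_top[symmetric])
      finally have "(1 - 1 / real n) * prob {\<omega>\<in>space Q. y2 \<le> Z \<omega>} \<le> \<epsilon>" using sol by simp
      moreover have "(1 + \<epsilon>) / 2 * ((1 + \<epsilon>) / 2) < (1 - 1 / real n) * prob {\<omega>\<in>space Q. y2 \<le> Z \<omega>}"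
        using n2 p2 \<epsilon> by (intro mult_le_less_imp_less) (auto simp: field_simps)
      \<comment> \<open>AM-GM for 1 and \<epsilon>.\<close>
      moreover have "\<epsilon> \<le> (1 + \<epsilon>) / 2 * ((1 + \<epsilon>) / 2)"
        using zero_le_square[of "1 - \<epsilon>"] by (simp add: field_simps)
      ultimately show False by linarith
    qed
    ultimately show "1 / (4 * y1) * real n \<le> t \<and> t \<le> 2 / y2 * real n" by linarith
  qed (use y in auto)
qed

end

section \<open>Transmission capacity\<close>

context gamma_sources
begin

lemma stable_variable_interference:
  "stable_variable Q (\<lambda>\<omega>. interference \<omega> / (\<mu> * kap) powr (\<alpha> / 2)) (2 / \<alpha>)"
proof (unfold_locales, goal_cases)
  case 2
  show ?case using interference_AE by eventually_elim auto
next
  case (3 s)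
  have "(s / (\<mu> * kap) powr (\<alpha> / 2)) powr (2 / \<alpha>) = s powr (2 / \<alpha>) / (\<mu> * kap)"
    using 3 \<alpha> mu_pos kap_pos by (simp add: powr_divide powr_powr)
  then have "\<mu> * kap * (s / (\<mu> * kap) powr (\<alpha> / 2)) powr (2 / \<alpha>) = s powr (2 / \<alpha>)"
    using mu_pos kap_pos by simp
  with interference_laplace[of "s / (\<mu> * kap) powr (\<alpha> / 2)"] show ?case
    using 3 mu_pos kap_pos by simp
qed (use \<alpha> in auto)

text \<open>\<open>Z\<close> may live on another probability space. The interference and
  \<open>r * Z\<close> have the same Laplace transform, hence give the same expectation to
  continuous functions of \<open>exp (- u)\<close> on [0, 1].\<close>

lemma outage_prob_eq_outage_law:
  assumes Z: "stable_variable Q0 Z (2 / \<alpha>)"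
    and W: "gamma_distributed Q W (real n) \<theta>'" and n: "0 < n" and \<theta>': "0 < \<theta>'" and \<beta>: "0 < \<beta>"
  shows "outage_prob \<alpha> S \<beta> \<mu>
    = stable_variable.outage_law Q0 Z n (\<beta> / \<theta>') (\<beta> / \<theta>' * (\<mu> * kap) powr (\<alpha> / 2))"
proof -
  interpret Z: stable_variable Q0 Z "2 / \<alpha>" by fact
  define b r where "b = \<beta> / \<theta>'" and "r = (\<mu> * kap) powr (\<alpha> / 2)"
  have b: "0 < b" using \<beta> \<theta>' by (simp add: b_def)
  have r: "0 < r" using mu_pos kap_pos by (simp add: r_def)
  \<comment> \<open>The value 1 at \<open>z = 0\<close>, that is at infinite interference, is the
    continuous extension, since the Erlang distribution function tends to 1.\<close>
  define \<psi> where "\<psi> z = (if z \<le> 0 then 1 else erlang_CDF (n - 1) 1 (b + b * (- ln z)))" for z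
  have \<psi>_exp: "\<psi> (exp (- u)) = erlang_CDF (n - 1) 1 (b + b * u)" for u
    by (simp add: \<psi>_def)
  have "outage_prob \<alpha> S \<beta> \<mu> = (\<integral>\<omega>. \<psi> (exp (- interference \<omega>)) \<partial>Q)"
    unfolding outage_prob_eq[OF W n \<theta>' \<beta>] \<psi>_exp b_def by (simp add: algebra_simps)
  also have "\<dots> = (\<integral>\<omega>. \<psi> (exp (- (r * Z \<omega>))) \<partial>Q0)"
  proof (rule laplace_transform_unique[OF prob_space_S Z.prob_space_axioms])
    show "AE \<omega> in Q. 0 \<le> interference \<omega>" using interference_AE by eventually_elim auto
    show "AE \<omega> in Q0. 0 \<le> r * Z \<omega>" using Z.Z_nonneg by eventually_elim (use r in auto)
    show "\<psi> \<in> borel_measurable borel" unfolding \<psi>_def[abs_def] by measurable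
    show "continuous_on {0..1} \<psi>"
      unfolding continuous_on_def
    proof
      fix x :: real assume x: "x \<in> {0..1}"
      show "(\<psi> \<longlongrightarrow> \<psi> x) (at x within {0..1})"
      proof (cases "x = 0")
        case True
        have "filterlim (\<lambda>z. b + b * (- ln z)) at_top (at_right 0)"
          using b by (intro filterlim_tendsto_add_at_top[OF tendsto_const]
            filterlim_tendsto_pos_mult_at_top[OF tendsto_const]
            filterlim_compose[OF filterlim_uminus_at_top_at_bot ln_at_0]) auto
        from filterlim_compose[OF erlang_CDF_at_top this]
        have "((\<lambda>z. erlang_CDF (n - 1) 1 (b + b * (- ln z))) \<longlongrightarrow> 1) (at_right 0)" .
        moreover have "eventually (\<lambda>z. erlang_CDF (n - 1) 1 (b + b * (- ln z)) = \<psi> z) (at_right 0)"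
          using eventually_at_right_less[of 0] by eventually_elim (simp add: \<psi>_def)
        ultimately have "(\<psi> \<longlongrightarrow> 1) (at_right 0)" by (rule Lim_transform_eventually)
        moreover have "at (0::real) within {0..1} \<le> at_right 0"
          unfolding at_within_def by (intro inf_mono) auto
        ultimately show ?thesis using True by (auto simp: \<psi>_def intro: filterlim_mono)
      next
        case False
        then have x0: "0 < x" using x by simp
        have "((\<lambda>z. erlang_CDF (n - 1) 1 (b + b * (- ln z))) \<longlongrightarrow> erlang_CDF (n - 1) 1 (b + b * (- ln x))) (at x within {0..1})"
          using x0 by (intro tendsto_erlang_CDF tendsto_intros) auto
        moreover have "eventually (\<lambda>z. 0 < z) (at x within {0..1})"
          using x0 by (intro order_tendstoD(1)[OF tendsto_ident_at])
        then have "eventually (\<lambda>z. erlang_CDF (n - 1) 1 (b + b * (- ln z)) = \<psi> z) (at x within {0..1})"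
          by eventually_elim (simp add: \<psi>_def)
        ultimately have "(\<psi> \<longlongrightarrow> erlang_CDF (n - 1) 1 (b + b * (- ln x))) (at x within {0..1})"
          by (rule Lim_transform_eventually)
        then show ?thesis using x0 by (simp add: \<psi>_def)
      qed
    qed
    fix k :: nat assume k: "0 < k"
    have "(real k * r) powr (2 / \<alpha>) = \<mu> * kap * real k powr (2 / \<alpha>)"
      using mu_pos kap_pos \<alpha> by (simp add: r_def powr_mult powr_powr)
    then show "(\<integral>\<omega>. exp (- (real k * interference \<omega>)) \<partial>Q) = (\<integral>\<omega>. exp (- (real k * (r * Z \<omega>))) \<partial>Q0)"
      using interference_laplace[of "real k"] Z.Z_laplace[of "real k * r"] k r by (simp add: mult.assoc)
  qed auto
  also have "\<dots> = Z.outage_law n b (b * r)"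
    unfolding \<psi>_exp Z.outage_law_def by (simp add: mult.assoc)
  finally show ?thesis by (simp add: b_def r_def)
qed

end

lemma gamma_sources_approx_sinr_model:
  assumes "2 < \<alpha>" "0 < \<rho>" "0 < R" "1 \<le> M" "0 < NI" "0 < \<mu>"
    and S: "approx_sinr_model \<alpha> rtr \<rho> N M R NI S"
  shows "gamma_sources S \<mu> (real NI / real M) (\<rho> / (R * real M)) \<alpha>"
  unfolding gamma_sources_def sinr_sources_def gamma_sources_axioms_def
proof (intro conjI allI)
  from S have marks: "gamma_distributed (prob_sp S) (marks S l) (real NI / real M) (\<rho> / (R * real M))" for l
    by (simp add: approx_sinr_model_def)
  show "prob_space (prob_sp S)" "homogeneous_ppp (prob_sp S) \<mu> (nodes S \<mu>)"
    "prob_space.indep_sets (prob_sp S) (source_events S \<mu>) UNIV"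
    "signal S \<in> borel_measurable (prob_sp S)"
    using S \<open>0 < \<mu>\<close> by (auto simp: approx_sinr_model_def gamma_distributed_def distributed_def)
  show "marks S l \<in> borel_measurable (prob_sp S)" for l
    using marks[of l] by (simp add: gamma_distributed_def distributed_def)
  have "distr (prob_sp S) borel (marks S l) = distr (prob_sp S) lborel (marks S l)" for l
    by (rule distr_cong) auto
  then show "distr (prob_sp S) borel (marks S l) = density lborel (\<lambda>x. ennreal (gamma_density (real NI / real M) (\<rho> / (R * real M)) x))" for l
    using marks[of l] by (simp add: gamma_distributed_def distributed_def)
qed (use assms in auto)

text \<open>The outage probability depends on the intensity through the increasing map
  \<open>T\<close>, so inverting it in \<open>\<mu>\<close> amounts to solving for
  \<open>t\<close>.\<close>

lemma transmission_capacity_eq: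
  assumes Z: "stable_variable Q0 Z (2 / \<alpha>)"
    and "2 < \<alpha>" "0 < rtr" "0 < \<rho>" "0 < \<beta>" "0 < \<epsilon>" "\<epsilon> < 1" "0 < R" "1 \<le> M" "M \<le> N" "0 < NI"
    and S: "approx_sinr_model \<alpha> rtr \<rho> N M R NI S"
    and SU: "outage_prob_SU S \<beta> < \<epsilon>"
  obtains t where "0 < t"
    "stable_variable.outage_law Q0 Z (M * N) (\<beta> * (R * real M * rtr powr \<alpha>) / \<rho>) t = \<epsilon>"
    "transmission_capacity R \<alpha> S \<beta> \<epsilon> =
       (1 - \<epsilon>) / (pi * Gamma (1 - 2 / \<alpha>) * (\<beta> * rtr powr \<alpha>) powr (2 / \<alpha>)) *
       (R * (Gamma (real NI / real M) / Gamma (real NI / real M + 2 / \<alpha>)) * t powr (2 / \<alpha>))"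
proof -
  interpret Z: stable_variable Q0 Z "2 / \<alpha>" by fact
  define n where "n = M * N"
  define \<theta>' where "\<theta>' = \<rho> / (R * real M * rtr powr \<alpha>)"
  define \<theta> where "\<theta> = \<rho> / (R * real M)"
  define v where "v = real NI / real M"
  define b where "b = \<beta> / \<theta>'"
  define q where "q = Gamma (v + 2 / \<alpha>) / Gamma v"
  define K where "K = pi * Gamma (1 - 2 / \<alpha>)"
  have n: "0 < n" and \<theta>': "0 < \<theta>'" and \<theta>: "0 < \<theta>" and v: "0 < v" using assms by (auto simp: n_def \<theta>'_def \<theta>_def v_def)
  have b: "0 < b" using assms \<theta>' by (simp add: b_def)
  have q: "0 < q" unfolding q_def using v assms by (intro divide_pos_pos Gamma_real_pos add_pos_pos) auto
  have K: "0 < K" unfolding K_def using assms by (intro mult_pos_pos Gamma_real_pos) auto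
  have b_eq: "b = \<beta> * (R * real M * rtr powr \<alpha>) / \<rho>" by (simp add: b_def \<theta>'_def)
  have W: "gamma_distributed (prob_sp S) (signal S) (real n) \<theta>'"
    using S by (simp add: approx_sinr_model_def n_def \<theta>'_def)
  have gs: "gamma_sources S \<mu> v \<theta> \<alpha>" if "0 < \<mu>" for \<mu>
    unfolding v_def \<theta>_def using assms that by (intro gamma_sources_approx_sinr_model[OF _ _ _ _ _ _ S]) auto
  define T where "T \<mu> = b * (\<mu> * (K * \<theta> powr (2 / \<alpha>) * q)) powr (\<alpha> / 2)" for \<mu>
  have outage: "outage_prob \<alpha> S \<beta> \<mu> = Z.outage_law n b (T \<mu>)" if "0 < \<mu>" for \<mu>
  proof -
    interpret G: gamma_sources S \<mu> v \<theta> \<alpha> by (rule gs[OF that])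
    have "G.kap = K * \<theta> powr (2 / \<alpha>) * q" by (simp add: G.kap_def K_def q_def)
    then show ?thesis
      using G.outage_prob_eq_outage_law[OF Z W n \<theta>'] assms by (simp add: b_def T_def)
  qed
  have D: "distributed (prob_sp S) lborel (signal S) (erlang_density (n - 1) (1 / \<theta>'))"
    using W n \<theta>' by (simp add: gamma_distributed_iff_erlang)
  interpret P: prob_space "prob_sp S" using S by (simp add: approx_sinr_model_def)
  have "outage_prob_SU S \<beta> = erlang_CDF (n - 1) 1 b"
    using P.erlang_distributed_le[OF D, of \<beta>] \<theta>' assms
    by (simp add: outage_prob_SU_def erlang_CDF_transform[of "1 / \<theta>'"] b_def)
  with SU assms obtain t where t: "0 < t" "Z.outage_law n b t = \<epsilon>"
    using Z.outage_law_attains[of n b \<epsilon>] by auto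
  define \<mu> where "\<mu> = (t / b) powr (2 / \<alpha>) / (K * \<theta> powr (2 / \<alpha>) * q)"
  have pos: "0 < K * \<theta> powr (2 / \<alpha>) * q" using K q \<theta> by simp
  have \<mu>: "0 < \<mu>" unfolding \<mu>_def using pos t b by simp
  have T\<mu>: "T \<mu> = t" using pos t b assms K q \<theta> by (simp add: T_def \<mu>_def powr_powr)
  have T_mono: "T x < T y" if "0 < x" "x < y" for x y
    unfolding T_def using that pos b assms by (intro mult_strict_left_mono powr_less_mono2 mult_strict_right_mono) auto
  have T_pos: "0 < T x" if "0 < x" for x unfolding T_def using that pos b K \<theta> q by simp
  have law_mono: "Z.outage_law n b (T x) < Z.outage_law n b (T y)" if "0 < x" "x < y" for x y
    using that T_mono[OF that] T_pos[of x] b by (intro Z.outage_law_strict_mono) auto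
  \<comment> \<open>\<open>the_inv_into\<close> returns the solution only once its uniqueness is
    known.\<close>
  have inj: "inj_on (outage_prob \<alpha> S \<beta>) {0<..}"
  proof (rule linorder_inj_onI)
    fix x y :: real assume "x < y" "x \<in> {0<..}" "y \<in> {0<..}"
    then show "outage_prob \<alpha> S \<beta> x \<noteq> outage_prob \<alpha> S \<beta> y"
      using law_mono[of x y] by (simp add: outage)
  qed auto
  have "intensity_at_outage \<alpha> S \<beta> \<epsilon> = \<mu>"
    unfolding intensity_at_outage_def
    using inj \<mu> t T\<mu> by (intro the_inv_into_f_eq) (auto simp: outage)
  moreover have "\<mu> = t powr (2 / \<alpha>) / (K * (\<beta> * rtr powr \<alpha>) powr (2 / \<alpha>) * q)"
  proof -
    \<comment> \<open>The scales of signal and marks differ only by the path loss, so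
      \<open>\<rho>\<close>, \<open>R\<close> and \<open>M\<close> cancel. This frees the prefactor
      of the capacity from them.\<close>
    have "b * \<theta> = \<beta> * rtr powr \<alpha>" using assms by (simp add: b_eq \<theta>_def)
    then have "b powr (2 / \<alpha>) * \<theta> powr (2 / \<alpha>) = (\<beta> * rtr powr \<alpha>) powr (2 / \<alpha>)"
      using b \<theta> by (simp add: powr_mult[symmetric])
    moreover have "\<mu> = t powr (2 / \<alpha>) / (K * (b powr (2 / \<alpha>) * \<theta> powr (2 / \<alpha>)) * q)"
      using t b by (simp add: \<mu>_def powr_divide mult_ac)
    ultimately show ?thesis by simp
  qed
  ultimately have "transmission_capacity R \<alpha> S \<beta> \<epsilon> =
       (1 - \<epsilon>) / (K * (\<beta> * rtr powr \<alpha>) powr (2 / \<alpha>)) * (R * (1 / q) * t powr (2 / \<alpha>))"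
    by (simp add: transmission_capacity_def)
  moreover have "1 / q = Gamma v / Gamma (v + 2 / \<alpha>)" by (simp add: q_def)
  ultimately show ?thesis using t that[of t] by (simp add: K_def v_def n_def b_eq)
qed

text \<open>The solution \<open>t\<close> is of order M N with constants from the common
  \<open>Z\<close>, and the capacity is a fixed multiple of \<open>R\<close>, the inverse Gamma
  ratio and \<open>t powr (2 / \<alpha>)\<close>.\<close>

lemma transmission_capacity_scaling:
  fixes \<alpha> rtr \<rho> \<beta> \<epsilon> :: real and R :: "nat \<Rightarrow> real" and NI :: "nat \<Rightarrow> nat"
    and S :: "nat \<Rightarrow> nat \<Rightarrow> 'w sinr_model"
  assumes par: "2 < \<alpha>" "0 < rtr" "0 < \<rho>" "0 < \<beta>" "0 < \<epsilon>" "\<epsilon> < 1"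
    and R: "\<And>M. 1 \<le> M \<Longrightarrow> 0 < R M \<and> R M \<le> 1"
    and NI: "\<And>M. 1 \<le> M \<Longrightarrow> 0 < NI M"
    and S: "\<And>N M. 1 \<le> M \<Longrightarrow> M \<le> N \<Longrightarrow> approx_sinr_model \<alpha> rtr \<rho> N M (R M) (NI M) (S N M)"
    and SU: "\<forall>\<^sub>F N in sequentially. \<forall>M\<in>{1..N}. outage_prob_SU (S N M) \<beta> < \<epsilon>"
  obtains c1 c2 where "0 < c1" "0 < c2"
    "\<forall>\<^sub>F N in sequentially. \<forall>M\<in>{1..N}.
       c1 * (scaling_factor \<alpha> (R M) (NI M) M * real N powr (2 / \<alpha>))
         \<le> transmission_capacity (R M) \<alpha> (S N M) \<beta> \<epsilon> \<and>
       transmission_capacity (R M) \<alpha> (S N M) \<beta> \<epsilon>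
         \<le> c2 * (scaling_factor \<alpha> (R M) (NI M) M * real N powr (2 / \<alpha>))"
proof -
  \<comment> \<open>The model for N = M = 1 at intensity 1 supplies the reference variable for all
    models.\<close>
  interpret G: gamma_sources "S 1 1" 1 "real (NI 1) / real 1" "\<rho> / (R 1 * real 1)" \<alpha>
    using par R[of 1] NI[of 1] by (intro gamma_sources_approx_sinr_model[OF _ _ _ _ _ _ S]) auto
  obtain Z where "stable_variable G.Q Z (2 / \<alpha>)" using G.stable_variable_interference by blast
  then interpret Z: stable_variable G.Q Z "2 / \<alpha>" .
  obtain a1 a2 n0 where a: "0 < a1" "0 < a2"
    and bnd: "\<And>n b t. n0 \<le> real n \<Longrightarrow> 0 < n \<Longrightarrow> 0 \<le> b \<Longrightarrow> b \<le> real n / 4 \<Longrightarrow> 0 \<le> t \<Longrightarrow>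
      Z.outage_law n b t = \<epsilon> \<Longrightarrow> a1 * real n \<le> t \<and> t \<le> a2 * real n"
    using Z.outage_law_solution_bounds[OF par(5,6)] by blast
  define B where "B = (1 - \<epsilon>) / (pi * Gamma (1 - 2 / \<alpha>) * (\<beta> * rtr powr \<alpha>) powr (2 / \<alpha>))"
  have B: "0 < B" unfolding B_def using par by (intro divide_pos_pos mult_pos_pos Gamma_real_pos) auto
  show thesis
  proof (rule that[of "B * a1 powr (2 / \<alpha>)" "B * a2 powr (2 / \<alpha>)"])
    \<comment> \<open>A threshold without \<open>M\<close>: \<open>M * N\<close> is at least
      \<open>N\<close>, and \<open>R M \<le> 1\<close> bounds \<open>b\<close> by \<open>M\<close>
      times a constant.\<close>
    have "\<forall>\<^sub>F N in sequentially. max n0 (4 * \<beta> * rtr powr \<alpha> / \<rho>) \<le> real N"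
      using filterlim_real_sequentially unfolding filterlim_at_top by blast
    with SU show "\<forall>\<^sub>F N in sequentially. \<forall>M\<in>{1..N}.
       B * a1 powr (2 / \<alpha>) * (scaling_factor \<alpha> (R M) (NI M) M * real N powr (2 / \<alpha>))
         \<le> transmission_capacity (R M) \<alpha> (S N M) \<beta> \<epsilon> \<and>
       transmission_capacity (R M) \<alpha> (S N M) \<beta> \<epsilon>
         \<le> B * a2 powr (2 / \<alpha>) * (scaling_factor \<alpha> (R M) (NI M) M * real N powr (2 / \<alpha>))"
    proof eventually_elim
      case (elim N)
      show ?case
      proof
        fix M assume "M \<in> {1..N}"
        then have M: "1 \<le> M" "M \<le> N" by auto
        define g where "g = Gamma (real (NI M) / real M) / Gamma (real (NI M) / real M + 2 / \<alpha>)"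
        have g: "0 \<le> R M * g" unfolding g_def using R[OF M(1)] NI[OF M(1)] M par
          by (intro mult_nonneg_nonneg divide_nonneg_nonneg less_imp_le[OF Gamma_real_pos] add_pos_pos) auto
        define b where "b = \<beta> * (R M * real M * rtr powr \<alpha>) / \<rho>"
        obtain t where t: "0 < t" "Z.outage_law (M * N) b t = \<epsilon>"
          "transmission_capacity (R M) \<alpha> (S N M) \<beta> \<epsilon> = B * (R M * g * t powr (2 / \<alpha>))"
          using transmission_capacity_eq[OF Z.stable_variable_axioms par conjunct1[OF R[OF M(1)]] M NI[OF M(1)] S[OF M]]
            elim(1) \<open>M \<in> {1..N}\<close> unfolding B_def g_def b_def by blast
        have "real N \<le> real (M * N)" using M by simp
        then have "n0 \<le> real (M * N)" using elim(2) by simp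
        moreover have b0: "0 \<le> b" using par R[OF M(1)] by (simp add: b_def)
        moreover have "b \<le> real (M * N) / 4"
        proof -
          have "b \<le> \<beta> * (1 * real M * rtr powr \<alpha>) / \<rho>"
            unfolding b_def using par R[OF M(1)] by (intro divide_right_mono mult_left_mono mult_right_mono) auto
          also have "\<dots> = real M * (4 * \<beta> * rtr powr \<alpha> / \<rho>) / 4" by simp
          also have "\<dots> \<le> real M * real N / 4"
            using elim(2) by (intro divide_right_mono mult_left_mono) auto
          finally show ?thesis by simp
        qed
        ultimately have tb: "a1 * real (M * N) \<le> t" "t \<le> a2 * real (M * N)"
          using bnd[of "M * N" b t] t M by auto
        \<comment> \<open>(M N)^(2/\<alpha>) splits into N^(2/\<alpha>) and the power of M in
          \<open>scaling_factor\<close>.\<close>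
        have sf: "scaling_factor \<alpha> (R M) (NI M) M * real N powr (2 / \<alpha>) = R M * g * real (M * N) powr (2 / \<alpha>)"
          using par by (simp add: scaling_factor_def g_def powr_mult)
        have lower: "B * (R M * g * (a1 * real (M * N)) powr (2 / \<alpha>)) \<le> B * (R M * g * t powr (2 / \<alpha>))"
          using B g tb a par by (intro mult_left_mono powr_mono2) auto
        have upper: "B * (R M * g * t powr (2 / \<alpha>)) \<le> B * (R M * g * (a2 * real (M * N)) powr (2 / \<alpha>))"
          using B g tb a par t by (intro mult_left_mono powr_mono2) auto
        have "B * (R M * g * (x * real (M * N)) powr (2 / \<alpha>)) = B * x powr (2 / \<alpha>) * (R M * g * real (M * N) powr (2 / \<alpha>))" for x
          unfolding powr_mult by (simp only: mult_ac)
        note eq = this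
        show "B * a1 powr (2 / \<alpha>) * (scaling_factor \<alpha> (R M) (NI M) M * real N powr (2 / \<alpha>))
         \<le> transmission_capacity (R M) \<alpha> (S N M) \<beta> \<epsilon> \<and>
         transmission_capacity (R M) \<alpha> (S N M) \<beta> \<epsilon>
         \<le> B * a2 powr (2 / \<alpha>) * (scaling_factor \<alpha> (R M) (NI M) M * real N powr (2 / \<alpha>))"
          unfolding t(3) sf eq[symmetric] using lower upper by blast
      qed
    qed
  qed (use a B in auto)
qed

section \<open>Scaling in the number of antennas\<close>

lemma bigtheta_antenna_choice:
  fixes c f :: "nat \<Rightarrow> nat \<Rightarrow> real"
  assumes "0 < a" "0 < b" and f: "\<And>N M. 0 \<le> f N M"
    and bnd: "\<forall>\<^sub>F N in sequentially. \<forall>M\<in>{1..N}. a * f N M \<le> c N M \<and> c N M \<le> b * f N M"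
    and m: "antenna_choice m"
  shows "(\<lambda>N. c N (m N)) \<in> \<Theta>(\<lambda>N. f N (m N))"
proof (rule bigthetaI'[OF assms(1,2)])
  show "\<forall>\<^sub>F N in sequentially. a * norm (f N (m N)) \<le> norm (c N (m N)) \<and> norm (c N (m N)) \<le> b * norm (f N (m N))"
    using bnd m[unfolded antenna_choice_def]
  proof eventually_elim
    case (elim N)
    then have "a * f N (m N) \<le> c N (m N)" "c N (m N) \<le> b * f N (m N)" by auto
    moreover have "0 \<le> a * f N (m N)" using f assms(1) by simp
    ultimately show ?case using f[of N "m N"] by simp
  qed
qed

text \<open>The upper bound is uniform in \<open>M\<close>, and \<open>M = 1\<close> is a competitor
  in the maximum.\<close>

lemma bigtheta_Max_antennas:
  fixes c :: "nat \<Rightarrow> nat \<Rightarrow> real"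
  assumes "0 < a" "0 < b" and f: "\<And>N. 0 \<le> f N"
    and upper: "\<forall>\<^sub>F N in sequentially. \<forall>M\<in>{1..N}. c N M \<le> b * f N"
    and lower: "\<forall>\<^sub>F N in sequentially. a * f N \<le> c N 1"
  shows "(\<lambda>N. MAX M\<in>{1..N}. c N M) \<in> \<Theta>(f)"
proof (rule bigthetaI'[OF assms(1,2)])
  show "\<forall>\<^sub>F N in sequentially. a * norm (f N) \<le> norm (MAX M\<in>{1..N}. c N M) \<and> norm (MAX M\<in>{1..N}. c N M) \<le> b * norm (f N)"
    using upper lower eventually_ge_at_top[of 1]
  proof eventually_elim
    case (elim N)
    have "c N 1 \<le> (MAX M\<in>{1..N}. c N M)" using elim(3) by (intro Max_ge) auto
    then have "a * f N \<le> (MAX M\<in>{1..N}. c N M)" using elim(2) by linarith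
    moreover have "(MAX M\<in>{1..N}. c N M) \<le> b * f N" using elim(1,3) by (subst Max_le_iff) auto
    moreover have "0 \<le> a * f N" using f assms(1) by simp
    ultimately show ?case using f[of N] by simp
  qed
qed

section \<open>Size of the code-dependent factor\<close>

lemma inverse_Gamma_ratio_bounds:
  fixes v d :: real
  assumes "1 \<le> v" "0 < d" "d < 1"
  shows "v powr (- d) \<le> Gamma v / Gamma (v + d)" "Gamma v / Gamma (v + d) \<le> 2 * v powr (- d)"
proof -
  have g: "0 < Gamma v" "0 < Gamma (v + d)" using assms by (auto intro!: Gamma_real_pos)
  show "v powr (- d) \<le> Gamma v / Gamma (v + d)"
    using Gamma_ratio_bounds(1)[of v d] assms g by (simp add: powr_minus field_simps)
  show "Gamma v / Gamma (v + d) \<le> 2 * v powr (- d)"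
    using Gamma_ratio_ge[of v d] assms g by (simp add: powr_minus field_simps)
qed

lemma scaling_factor_nonneg:
  assumes "0 < \<alpha>" "0 \<le> R" shows "0 \<le> scaling_factor \<alpha> R NI M"
proof -
  have "0 \<le> Gamma (real NI / real M)"
  \<comment> \<open>In the degenerate case the argument is 0, and \<open>Gamma 0 = 0\<close> in
    HOL.\<close>
  proof (cases "NI = 0 \<or> M = 0")
    case False
    then show ?thesis by (intro less_imp_le[OF Gamma_real_pos]) simp
  qed auto
  moreover have "0 \<le> Gamma (real NI / real M + 2 / \<alpha>)"
    using assms by (intro less_imp_le[OF Gamma_real_pos] add_nonneg_pos) auto
  ultimately show ?thesis using assms by (simp add: scaling_factor_def)
qed

text \<open>The mark shape is at least 1 and at least R M, so with d = 2/\<alpha> the inverse Gamma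
  ratio is at most 2 (R M)^(-d). The powers of M cancel and leave 2 R^(1-d) \<le> 2.\<close>

lemma scaling_factor_le:
  assumes \<alpha>: "2 < \<alpha>" and M: "1 \<le> M" and R: "0 < R" "R \<le> 1" and "M \<le> NI" and NI: "R * (real M)\<^sup>2 \<le> real NI"
  shows "scaling_factor \<alpha> R NI M \<le> 2"
proof -
  let ?v = "real NI / real M" and ?d = "2 / \<alpha>"
  have v: "1 \<le> ?v" "R * real M \<le> ?v" using assms by (auto simp: field_simps power2_eq_square)
  have "?v powr (- ?d) \<le> (R * real M) powr (- ?d)"
    using v R M \<alpha> by (intro powr_mono2') auto
  then have "Gamma ?v / Gamma (?v + ?d) \<le> 2 * (R * real M) powr (- ?d)"
    using inverse_Gamma_ratio_bounds(2)[OF v(1), of ?d] \<alpha> by simp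
  then have "scaling_factor \<alpha> R NI M \<le> R * real M powr ?d * (2 * (R * real M) powr (- ?d))"
    unfolding scaling_factor_def using R by (intro mult_left_mono) auto
  also have "\<dots> = 2 * R powr (1 - ?d)"
    using R M by (simp add: powr_mult powr_minus powr_diff field_simps)
  also have "\<dots> \<le> 2 * 1" using R \<alpha> by (intro mult_left_mono powr_le1) auto
  finally show ?thesis by simp
qed

lemma scaling_factor_min_rate:
  "1 \<le> M \<Longrightarrow> scaling_factor \<alpha> (1 / real M) M M = real M powr (2 / \<alpha> - 1) / Gamma (1 + 2 / \<alpha>)"
  by (simp add: scaling_factor_def powr_diff)

text \<open>The mark shape lies between M/2 and 2M, so the inverse Gamma ratio is of order
  M^(-2/\<alpha>) and cancels the power of M. The numbers 1/4 and 4 come from 2^(2/\<alpha>) \<le>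
  2, from 1/2 \<le> R \<le> 1 and from the factor 2 in the Gamma bound.\<close>

lemma scaling_factor_max_rate_bounds:
  assumes \<alpha>: "2 < \<alpha>" and M: "1 \<le> M" and R: "1 / 2 \<le> R" "R \<le> 1"
    and NI: "real M * (real M + 1) / 2 \<le> real NI" "real NI \<le> real M * (real M + 2) / 2"
  shows "1 / 4 \<le> scaling_factor \<alpha> R NI M" "scaling_factor \<alpha> R NI M \<le> 4"
proof -
  let ?v = "real NI / real M" and ?d = "2 / \<alpha>"
  have d: "0 < ?d" "?d < 1" using \<alpha> by auto
  have v: "1 \<le> ?v" "real M / 2 \<le> ?v" "?v \<le> 2 * real M"
  proof -
    have "(real M + 1) / 2 \<le> ?v" "?v \<le> (real M + 2) / 2" using NI M by (simp_all add: field_simps)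
    moreover have "1 \<le> (real M + 1) / 2" "real M / 2 \<le> (real M + 1) / 2" "(real M + 2) / 2 \<le> 2 * real M"
      using M by simp_all
    ultimately show "1 \<le> ?v" "real M / 2 \<le> ?v" "?v \<le> 2 * real M" by (blast intro: order_trans)+
  qed
  have p: "(2::real) powr ?d \<le> 2" using powr_mono[of ?d 1 "2::real"] d by simp
  have "(2 * real M) powr (- ?d) \<le> ?v powr (- ?d)"
    using v d by (intro powr_mono2') auto
  then have "1 / 2 * real M powr ?d * (2 * real M) powr (- ?d) \<le> R * real M powr ?d * (Gamma ?v / Gamma (?v + ?d))"
    using inverse_Gamma_ratio_bounds(1)[OF v(1) d] R by (intro mult_mono) auto
  moreover have "1 / 2 * real M powr ?d * (2 * real M) powr (- ?d) = 1 / (2 * 2 powr ?d)"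
    using M by (simp add: powr_mult powr_minus field_simps)
  ultimately have "1 / (2 * 2 powr ?d) \<le> scaling_factor \<alpha> R NI M" by (simp only: scaling_factor_def)
  moreover have "1 / 4 \<le> 1 / (2 * (2::real) powr ?d)" using p by (intro divide_left_mono) auto
  ultimately show "1 / 4 \<le> scaling_factor \<alpha> R NI M" by linarith
  have "?v powr (- ?d) \<le> (real M / 2) powr (- ?d)"
    using v d M by (intro powr_mono2') auto
  then have "R * real M powr ?d * (Gamma ?v / Gamma (?v + ?d)) \<le> 1 * real M powr ?d * (2 * (real M / 2) powr (- ?d))"
    using inverse_Gamma_ratio_bounds(2)[OF v(1) d] R
      order_trans[OF powr_ge_zero inverse_Gamma_ratio_bounds(1)[OF v(1) d]]
    by (intro mult_mono) auto
  also have "\<dots> = 2 * 2 powr ?d"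
    using M by (simp add: powr_divide powr_minus field_simps)
  finally show "scaling_factor \<alpha> R NI M \<le> 4" using p by (simp add: scaling_factor_def)
qed

theorem mainTheorem7:
  fixes \<alpha> rtr \<rho> \<beta> \<epsilon> :: real
    and C :: "nat \<Rightarrow> ostbc_code"
    and R :: "nat \<Rightarrow> real"
    and NI :: "nat \<Rightarrow> nat"
    and S :: "nat \<Rightarrow> nat \<Rightarrow> 'w sinr_model"
    and c :: "nat \<Rightarrow> nat \<Rightarrow> real"
  assumes "2 < \<alpha>" and "0 < rtr" and "0 < \<rho>" and "0 < \<beta>" and "0 < \<epsilon>" and "\<epsilon> < 1"
    and "\<And>M. 1 \<le> M \<Longrightarrow> is_ostbc M (C M)"
    and "\<And>M. 1 \<le> M \<Longrightarrow> R M = code_rate (C M)"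
    and "\<And>M. 1 \<le> M \<Longrightarrow> has_code_parameter M (C M) (NI M)"
    and "\<And>N M. 1 \<le> M \<Longrightarrow> M \<le> N \<Longrightarrow> approx_sinr_model \<alpha> rtr \<rho> N M (R M) (NI M) (S N M)"
    and "\<forall>\<^sub>F N in sequentially. \<forall>M\<in>{1..N}. outage_prob_SU (S N M) \<beta> < \<epsilon>"
    and c_def: "\<And>N M. c N M = transmission_capacity (R M) \<alpha> (S N M) \<beta> \<epsilon>"
  shows
    "(\<forall>m. antenna_choice m \<longrightarrow>
        (\<lambda>N. c N (m N)) \<in>
          \<Theta>(\<lambda>N. scaling_factor \<alpha> (R (m N)) (NI (m N)) (m N) * real N powr (2 / \<alpha>)))
     \<and>
     ((\<forall>M\<ge>1. R M = 1 / real M \<and> NI M = M) \<longrightarrow>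
        (\<forall>m. antenna_choice m \<longrightarrow>
           (\<lambda>N. c N (m N)) \<in> \<Theta>(\<lambda>N. real (m N) powr (2 / \<alpha> - 1) * real N powr (2 / \<alpha>))) \<and>
        (\<forall>N\<ge>1. is_arg_max (\<lambda>M. real M powr (2 / \<alpha> - 1) * real N powr (2 / \<alpha>))
                  (\<lambda>M. 1 \<le> M \<and> M \<le> N) 1) \<and>
        (\<lambda>N. c N 1) \<in> \<Theta>(\<lambda>N. real N powr (2 / \<alpha>)) \<and>
        (\<lambda>N. MAX M\<in>{1..N}. c N M) \<in> \<Theta>(\<lambda>N. real N powr (2 / \<alpha>)))
     \<and>
     ((\<forall>M\<ge>1.
         (even M \<longrightarrow>
            1 / 2 < R M \<and> R M \<le> (real M + 2) / (2 * real M) \<and>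
            real (NI M) = real M * (real M + 2) / 2) \<and>
         (odd M \<longrightarrow>
            1 / 2 < R M \<and> R M \<le> (real M + 3) / (2 * (real M + 1)) \<and>
            real M * (real M + 1) / 2 \<le> real (NI M) \<and>
            real (NI M) < real M * (real M + 2) / 2)) \<longrightarrow>
        (\<forall>m. antenna_choice m \<longrightarrow> (\<lambda>N. c N (m N)) \<in> \<Theta>(\<lambda>N. real N powr (2 / \<alpha>))) \<and>
        (\<lambda>N. MAX M\<in>{1..N}. c N M) \<in> \<Theta>(\<lambda>N. real N powr (2 / \<alpha>)))
     \<and>
     (\<forall>m. antenna_choice m \<longrightarrow> (\<lambda>N. c N (m N)) \<in> o(\<lambda>N. real N))"
proof -
  note par = assms(1-6) and C = assms(7) and rate = assms(8) and NI = assms(9) and S = assms(10) and SU = assms(11)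
  have R: "0 < R M \<and> R M \<le> 1" if "1 \<le> M" for M
    using code_rate_bounds[OF C[OF that] that] by (simp add: rate[OF that])
  have NI_ge: "M \<le> NI M" "R M * (real M)\<^sup>2 \<le> real (NI M)" if "1 \<le> M" for M
    using code_parameter_ge_antennas[OF C[OF that] NI[OF that]] code_parameter_ge[OF C[OF that] NI[OF that]]
    by (simp_all add: rate[OF that])
  have NI_pos: "0 < NI M" if "1 \<le> M" for M using NI_ge(1)[OF that] that by simp
  \<comment> \<open>The hypotheses say nothing about \<open>R 0\<close> and \<open>NI 0\<close>,
    while sign and upper bound are wanted for every argument.\<close>
  define g where "g M = (if 1 \<le> M then scaling_factor \<alpha> (R M) (NI M) M else 0)" for M
  define p where "p N = real N powr (2 / \<alpha>)" for N :: nat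
  have g_nonneg: "0 \<le> g M" for M using R[of M] par by (auto simp: g_def intro!: scaling_factor_nonneg)
  have p_nonneg: "0 \<le> p N" for N by (simp add: p_def)
  obtain a b where ab: "0 < a" "0 < b" and bnd: "\<forall>\<^sub>F N in sequentially. \<forall>M\<in>{1..N}.
       a * (scaling_factor \<alpha> (R M) (NI M) M * real N powr (2 / \<alpha>))
         \<le> transmission_capacity (R M) \<alpha> (S N M) \<beta> \<epsilon> \<and>
       transmission_capacity (R M) \<alpha> (S N M) \<beta> \<epsilon>
         \<le> b * (scaling_factor \<alpha> (R M) (NI M) M * real N powr (2 / \<alpha>))"
    by (rule transmission_capacity_scaling[OF par R NI_pos S SU])
  have c: "\<forall>\<^sub>F N in sequentially. \<forall>M\<in>{1..N}. a * (g M * p N) \<le> c N M \<and> c N M \<le> b * (g M * p N)"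
    using bnd by eventually_elim (auto simp: g_def p_def c_def)
  \<comment> \<open>Comparisons of \<open>g M * p N\<close> with an explicit \<open>f\<close> carry
    over to the capacity; both special code families are treated this way.\<close>
  have c_mono: "\<forall>\<^sub>F N in sequentially. \<forall>M\<in>{1..N}. a * l * f N M \<le> c N M \<and> c N M \<le> b * u * f N M"
    if "\<And>N M. 1 \<le> M \<Longrightarrow> l * f N M \<le> g M * p N" "\<And>N M. 1 \<le> M \<Longrightarrow> g M * p N \<le> u * f N M" for l u f
    using c
  proof eventually_elim
    case (elim N)
    show ?case
    proof
      fix M assume M: "M \<in> {1..N}"
      then have "a * (l * f N M) \<le> a * (g M * p N)" "b * (g M * p N) \<le> b * (u * f N M)"
        using that ab by (auto intro!: mult_left_mono)
      then show "a * l * f N M \<le> c N M \<and> c N M \<le> b * u * f N M"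
        using elim M by (auto simp: mult.assoc intro: order_trans)
    qed
  qed
  have thm1: "(\<lambda>N. c N (m N)) \<in> \<Theta>(\<lambda>N. scaling_factor \<alpha> (R (m N)) (NI (m N)) (m N) * real N powr (2 / \<alpha>))"
    if m: "antenna_choice m" for m
  proof -
    have "(\<lambda>N. c N (m N)) \<in> \<Theta>(\<lambda>N. g (m N) * p N)"
      using bigtheta_antenna_choice[OF ab _ c m] g_nonneg p_nonneg by simp
    also have "(\<lambda>N. g (m N) * p N) \<in> \<Theta>(\<lambda>N. scaling_factor \<alpha> (R (m N)) (NI (m N)) (m N) * real N powr (2 / \<alpha>))"
      using m[unfolded antenna_choice_def]
      by (intro bigthetaI_cong) (auto elim!: eventually_mono simp: g_def p_def)
    finally show ?thesis .
  qed
  have thm4: "(\<lambda>N. c N (m N)) \<in> o(\<lambda>N. real N)" if m: "antenna_choice m" for m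
  proof -
    \<comment> \<open>The bound holds for every orthogonal code, so the antenna choice drops out;
      sublinearity is then 2/\<alpha> < 1.\<close>
    have g2: "g M \<le> 2" for M using scaling_factor_le[of \<alpha> M "R M" "NI M"] R[of M] NI_ge[of M] par by (auto simp: g_def)
    have "(\<lambda>N. c N (m N)) \<in> O(p)"
    proof (rule bigoI[of _ "b * 2"])
      show "\<forall>\<^sub>F N in sequentially. norm (c N (m N)) \<le> b * 2 * norm (p N)"
        using c m[unfolded antenna_choice_def]
      proof eventually_elim
        case (elim N)
        then have "a * (g (m N) * p N) \<le> c N (m N)" "c N (m N) \<le> b * (g (m N) * p N)" by auto
        moreover have "0 \<le> a * (g (m N) * p N)" using ab g_nonneg p_nonneg by simp
        moreover have "b * (g (m N) * p N) \<le> b * (2 * p N)"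
          using ab g2 p_nonneg by (intro mult_left_mono mult_right_mono) auto
        ultimately show ?case using p_nonneg[of N] by simp
      qed
    qed
    also have "p \<in> o(\<lambda>N. real N)"
    proof -
      have "(\<lambda>N. real N powr (2 / \<alpha>)) \<in> o(\<lambda>N. real N powr 1)"
        using par by (subst powr_smallo_iff[OF filterlim_real_sequentially]) auto
      then show ?thesis by (simp add: p_def[abs_def])
    qed
    finally show ?thesis .
  qed
  have thm2: "(\<forall>m. antenna_choice m \<longrightarrow>
           (\<lambda>N. c N (m N)) \<in> \<Theta>(\<lambda>N. real (m N) powr (2 / \<alpha> - 1) * real N powr (2 / \<alpha>))) \<and>
        (\<forall>N\<ge>1. is_arg_max (\<lambda>M. real M powr (2 / \<alpha> - 1) * real N powr (2 / \<alpha>))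
                  (\<lambda>M. 1 \<le> M \<and> M \<le> N) 1) \<and>
        (\<lambda>N. c N 1) \<in> \<Theta>(\<lambda>N. real N powr (2 / \<alpha>)) \<and>
        (\<lambda>N. MAX M\<in>{1..N}. c N M) \<in> \<Theta>(\<lambda>N. real N powr (2 / \<alpha>))"
    if min_rate: "\<forall>M\<ge>1. R M = 1 / real M \<and> NI M = M"
  proof -
    define G where "G = 1 / Gamma (1 + 2 / \<alpha>)"
    have G: "0 < G" unfolding G_def using par by (intro divide_pos_pos Gamma_real_pos add_pos_pos) auto
    define f where "f N M = real M powr (2 / \<alpha> - 1) * p N" for N M :: nat
    have gf: "g M * p N = G * f N M" if "1 \<le> M" for M N
      using that min_rate scaling_factor_min_rate[of M \<alpha>] by (simp add: g_def f_def G_def)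
    have b1: "\<forall>\<^sub>F N in sequentially. \<forall>M\<in>{1..N}. a * G * f N M \<le> c N M \<and> c N M \<le> b * G * f N M"
      by (rule c_mono) (simp_all add: gf)
    have aG: "0 < a * G" "0 < b * G" using ab G by auto
    \<comment> \<open>The exponent \<open>2 / \<alpha> - 1\<close> is negative, so
      \<open>M = 1\<close> is optimal.\<close>
    have f1: "f N M \<le> p N" if "1 \<le> M" for N M
    proof -
      have "real M powr (2 / \<alpha> - 1) \<le> 1 powr (2 / \<alpha> - 1)"
        using that par by (intro powr_mono2') auto
      then show ?thesis using p_nonneg[of N] mult_right_mono[of "real M powr (2 / \<alpha> - 1)" 1 "p N"] by (simp add: f_def)
    qed
    have A1: "(\<lambda>N. c N (m N)) \<in> \<Theta>(\<lambda>N. real (m N) powr (2 / \<alpha> - 1) * real N powr (2 / \<alpha>))" if "antenna_choice m" for m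
      using bigtheta_antenna_choice[OF aG _ b1 that] by (simp add: f_def p_def)
    have A2: "is_arg_max (\<lambda>M. real M powr (2 / \<alpha> - 1) * real N powr (2 / \<alpha>)) (\<lambda>M. 1 \<le> M \<and> M \<le> N) 1" if "1 \<le> N" for N
      using that f1[of _ N] unfolding is_arg_max_def by (auto simp: f_def p_def not_less[symmetric])
    have "antenna_choice (\<lambda>_. 1)"
      unfolding antenna_choice_def using eventually_ge_at_top[of 1] by eventually_elim simp
    from A1[OF this] have A3: "(\<lambda>N. c N 1) \<in> \<Theta>(\<lambda>N. real N powr (2 / \<alpha>))" by simp
    have "(\<lambda>N. MAX M\<in>{1..N}. c N M) \<in> \<Theta>(p)"
    proof (rule bigtheta_Max_antennas[OF aG p_nonneg])
      show "\<forall>\<^sub>F N in sequentially. \<forall>M\<in>{1..N}. c N M \<le> b * G * p N"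
        using b1
      proof eventually_elim
        case (elim N)
        show ?case
        proof
          fix M assume M: "M \<in> {1..N}"
          have "b * G * f N M \<le> b * G * p N" using M aG f1[of M N] by (intro mult_left_mono) auto
          then show "c N M \<le> b * G * p N" using elim M by force
        qed
      qed
      show "\<forall>\<^sub>F N in sequentially. a * G * p N \<le> c N 1"
        using b1 eventually_ge_at_top[of 1]
      proof eventually_elim
        case (elim N)
        then have "a * G * f N 1 \<le> c N 1" by force
        then show ?case by (simp add: f_def)
      qed
    qed
    then have A4: "(\<lambda>N. MAX M\<in>{1..N}. c N M) \<in> \<Theta>(\<lambda>N. real N powr (2 / \<alpha>))" by (simp only: p_def[abs_def])
    show ?thesis using A1 A2 A3 A4 by blast
  qed
  have thm3: "(\<forall>m. antenna_choice m \<longrightarrow> (\<lambda>N. c N (m N)) \<in> \<Theta>(\<lambda>N. real N powr (2 / \<alpha>))) \<and>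
        (\<lambda>N. MAX M\<in>{1..N}. c N M) \<in> \<Theta>(\<lambda>N. real N powr (2 / \<alpha>))"
    if max_rate: "\<forall>M\<ge>1.
         (even M \<longrightarrow>
            1 / 2 < R M \<and> R M \<le> (real M + 2) / (2 * real M) \<and>
            real (NI M) = real M * (real M + 2) / 2) \<and>
         (odd M \<longrightarrow>
            1 / 2 < R M \<and> R M \<le> (real M + 3) / (2 * (real M + 1)) \<and>
            real M * (real M + 1) / 2 \<le> real (NI M) \<and>
            real (NI M) < real M * (real M + 2) / 2)"
  proof -
    have g14: "1 / 4 \<le> g M \<and> g M \<le> 4" if M: "1 \<le> M" for M
    proof -
      \<comment> \<open>Both parities are merged into one range for \<open>NI M\<close>: the odd
        case gives its lower end, the even case its upper end.\<close>
      have "1 / 2 \<le> R M" "real M * (real M + 1) / 2 \<le> real (NI M)" "real (NI M) \<le> real M * (real M + 2) / 2"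
      proof -
        have "real M * (real M + 1) / 2 \<le> real M * (real M + 2) / 2"
          by (intro divide_right_mono mult_left_mono) auto
        then show "1 / 2 \<le> R M" "real M * (real M + 1) / 2 \<le> real (NI M)" "real (NI M) \<le> real M * (real M + 2) / 2"
          using max_rate[rule_format, OF M] by (cases "even M"; simp)+
      qed
      then show ?thesis
        using scaling_factor_max_rate_bounds[of \<alpha> M "R M" "NI M"] par M R[OF M] by (simp add: g_def)
    qed
    have b1: "\<forall>\<^sub>F N in sequentially. \<forall>M\<in>{1..N}. a * (1 / 4) * p N \<le> c N M \<and> c N M \<le> b * 4 * p N"
      using g14 p_nonneg by (intro c_mono[of "1 / 4" "\<lambda>N M. p N"] mult_right_mono) auto
    have ab4: "0 < a * (1 / 4)" "0 < b * 4" using ab by auto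
    have "(\<lambda>N. c N (m N)) \<in> \<Theta>(\<lambda>N. real N powr (2 / \<alpha>))" if "antenna_choice m" for m
      using bigtheta_antenna_choice[OF ab4 p_nonneg b1 that] by (simp only: p_def)
    moreover have "(\<lambda>N. MAX M\<in>{1..N}. c N M) \<in> \<Theta>(p)"
    proof (rule bigtheta_Max_antennas[OF ab4 p_nonneg])
      show "\<forall>\<^sub>F N in sequentially. \<forall>M\<in>{1..N}. c N M \<le> b * 4 * p N"
        using b1 by eventually_elim blast
      show "\<forall>\<^sub>F N in sequentially. a * (1 / 4) * p N \<le> c N 1"
        using b1 eventually_ge_at_top[of 1]
      proof eventually_elim
        case (elim N)
        then show ?case by (auto dest: bspec[of _ _ 1])
      qed
    qed
    ultimately show ?thesis by (simp add: p_def[abs_def])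
  qed
  show ?thesis using thm1 thm2 thm3 thm4 by blast
qed

end
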